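(* Let $n\ge 2$ and $m$ be integers with $n-1\le m\le 2n-3$. Let $G$ be a connected graph with $n$ vertices and $m$ edges that minimizes the first degree-based entropy $I$ among all connected graphs with $n$ vertices and $m$ edges. Then $G$ has a universal vertex $v$ (a vertex of degree $n-1$) such that $G\setminus v$, which is a graph with $n-1$ vertices and $m'=m-n+1$ edges, is, up to isolated vertices: the edgeless graph if $m'=0$; the star $K_{1,m'}$ if $m'\ge 1$ and $m'\notin\{3,5,6\}$; $K_3$ if $m'=3$; one of $K_4^-$ and $K_{1,5}$ if $m'=5$; $K_4$ if $m'=6$. (These are the graphs with $m'$ edges maximizing $h_1$.) That is, the degree sequence of $G$ is $$\begin{cases} (n-1,\,m-n+2,\,2^{m-n+1},\,1^{2n-m-3}) & \text{if } n+6\le m\le 2n-3 \text{ or } m\in\{n,n+1,n+3\},\\ (n-1,\,4^{4},\,1^{n-5}) & \text{if } m=n+5,\\ (n-1,\,4^{2},\,3^{2},\,1^{n-5}) \text{ or } (n-1,\,6,\,2^{5},\,1^{n-7}) & \text{if } m=n+4,\\ (n-1,\,3^{3},\,1^{n-4}) & \text{if } m=n+2,\\ (n-1,\,1^{n-1}) & \text{if } m=n-1, \end{cases}$$ and in the case $m=n+4$ both listed degree sequences are attained by minimizers.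
   Context: All graphs are finite and simple. The order of a graph is its number of vertices and the size is its number of edges. For a graph $G$ of size $m\ge1$ with degree sequence $(d_i)_{1\le i\le n}$, the first degree-based entropy is $$I(G)=-\sum_{i=1}^n \frac{d_i}{2m}\log\left(\frac{d_i}{2m}\right),$$ where $\log$ is the natural logarithm. The function $h_1$ is defined by $h_1(G)=\sum_i (d_i+1)\log(d_i+1)$. In degree sequences, $a^{k}$ means that the value $a$ is repeated $k$ times. $K_4^-$ is the complete graph $K_4$ with one edge removed, and $K_{1,k}$ is the star with $k$ edges. "Up to isolated vertices" means after deleting all vertices of degree $0$. *)

theory Defs
  imports Complex_Main "HOL-Library.Multiset" "Graph_Theory.Graph_Theory"
begin

text \<open>
  A finite simple graph is a \<^term>\<open>graph\<close> of the Graph_Theory library: a finite, loop-free, symmetric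
  digraph without parallel arcs. Every undirected edge is thus represented by two opposite arcs,
  and the degree of a vertex is its out-degree (equivalently, its in-degree).
\<close>

definition uedges :: "('a, 'b) pre_digraph \<Rightarrow> 'a set set" where
  "uedges G = {{u, v} | u v. (u, v) \<in> arcs_ends G}"

definition gorder :: "('a, 'b) pre_digraph \<Rightarrow> nat" where
  "gorder G = card (verts G)"

definition gsize :: "('a, 'b) pre_digraph \<Rightarrow> nat" where
  "gsize G = card (uedges G)"

abbreviation gdeg :: "('a, 'b) pre_digraph \<Rightarrow> 'a \<Rightarrow> nat" where
  "gdeg G v \<equiv> out_degree G v"

text \<open>Degree sequences are considered up to order, i.e. as multisets.\<close>

definition degree_sequence :: "('a, 'b) pre_digraph \<Rightarrow> nat multiset" where
  "degree_sequence G = image_mset (gdeg G) (mset_set (verts G))"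

text \<open>
  Vertices of degree 0 contribute \<open>0 * ln 0 = 0\<close>, the usual convention.
\<close>

definition entropy :: "('a, 'b) pre_digraph \<Rightarrow> real" where
  "entropy G = - (\<Sum>v\<in>verts G. real (gdeg G v) / (2 * real (gsize G))
                      * ln (real (gdeg G v) / (2 * real (gsize G))))"

definition h1 :: "('a, 'b) pre_digraph \<Rightarrow> real" where
  "h1 G = (\<Sum>v\<in>verts G. (real (gdeg G v) + 1) * ln (real (gdeg G v) + 1))"

definition connected_graph :: "nat \<Rightarrow> nat \<Rightarrow> ('a, 'b) pre_digraph \<Rightarrow> bool" where
  "connected_graph n m G \<longleftrightarrow>
     graph G \<and> Digraph_Component.connected G \<and> gorder G = n \<and> gsize G = m"

text \<open>
  In both optimization problems below, the competitors \<open>H\<close> range over the graphs with vertices in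
  \<^typ>\<open>nat\<close> and arcs in \<^typ>\<open>nat \<times> nat\<close>; every finite simple graph is isomorphic to one of these.
\<close>

definition entropy_minimizer :: "nat \<Rightarrow> nat \<Rightarrow> ('a, 'b) pre_digraph \<Rightarrow> bool" where
  "entropy_minimizer n m G \<longleftrightarrow> connected_graph n m G \<and>
     (\<forall>H :: (nat, nat \<times> nat) pre_digraph. connected_graph n m H \<longrightarrow> entropy G \<le> entropy H)"

definition h1_maximizer :: "nat \<Rightarrow> ('a, 'b) pre_digraph \<Rightarrow> bool" where
  "h1_maximizer m G \<longleftrightarrow> graph G \<and> gsize G = m \<and>
     (\<forall>H :: (nat, nat \<times> nat) pre_digraph. graph H \<and> gsize H = m \<longrightarrow> h1 H \<le> h1 G)"

definition del_isolated :: "('a, 'b) pre_digraph \<Rightarrow> ('a, 'b) pre_digraph" where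
  "del_isolated G = induce_subgraph G {v \<in> verts G. gdeg G v \<noteq> 0}"

definition K4_minus :: "('a, 'b) pre_digraph \<Rightarrow> bool" where
  "K4_minus G \<longleftrightarrow> graph G \<and> card (verts G) = 4 \<and>
     (\<exists>u\<in>verts G. \<exists>v\<in>verts G. u \<noteq> v \<and>
        arcs_ends G = {(x, y). (x, y) \<in> verts G \<times> verts G \<and> x \<noteq> y} - {(u, v), (v, u)})"

definition star_graph :: "nat \<Rightarrow> ('a, 'b) pre_digraph \<Rightarrow> bool" where
  "star_graph k G \<longleftrightarrow> complete_bipartite_digraph 1 k G"

definition extremal_shape :: "nat \<Rightarrow> ('a, 'b) pre_digraph \<Rightarrow> bool" where
  "extremal_shape k G \<longleftrightarrow>
     (k = 0 \<longrightarrow> arcs G = {}) \<and>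
     (k \<ge> 1 \<and> k \<notin> {3, 5, 6} \<longrightarrow> star_graph k (del_isolated G)) \<and>
     (k = 3 \<longrightarrow> complete_digraph 3 (del_isolated G)) \<and>
     (k = 5 \<longrightarrow> K4_minus (del_isolated G) \<or> star_graph 5 (del_isolated G)) \<and>
     (k = 6 \<longrightarrow> complete_digraph 4 (del_isolated G))"

end

theory Submission
  imports Defs
begin

text \<open>
  Minimizing the entropy means maximizing \<open>\<Sum> d ln d\<close> over the degrees. If a vertex \<open>u\<close> of maximum
  degree is not universal, there is a path \<open>u v w\<close> with \<open>w\<close> not adjacent to \<open>u\<close>, and replacing the
  edge \<open>vw\<close> by \<open>uw\<close> keeps the graph connected and strictly increases the sum by convexity. For a
  universal vertex, the sum over the remaining vertices is \<open>h1\<close> of the graph without it.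

  The graphs with \<open>k\<close> edges maximizing \<open>h1\<close> are found by induction on \<open>k\<close>. Delete a vertex of maximum
  degree \<open>a\<close> and let \<open>b = k - a\<close>. Jensen's inequality, applied to the concave function
  \<open>(d + 2) ln (d + 2) - (d + 1) ln (d + 1)\<close> of the degrees \<open>d\<close> that the neighbours retain, bounds the
  loss, and the resulting comparison with the star is a function of \<open>(a, b)\<close> which vanishes for
  \<open>b = 0\<close> and, if \<open>a \<ge> 4\<close>, increases in \<open>b\<close>. For \<open>a \<le> 3\<close>, bounding \<open>(d + 1) ln (d + 1)\<close> by a chord
  leaves only finitely many cases.
\<close>

subsection \<open>Estimates for \<open>x ln x\<close>\<close>

definition xlnx :: "real \<Rightarrow> real" where
  "xlnx x = x * ln x"

lemma xlnx_0 [simp]: "xlnx 0 = 0" and xlnx_1 [simp]: "xlnx 1 = 0"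
  by (simp_all add: xlnx_def)

lemma DERIV_xlnx [derivative_intros]:
  assumes "(f has_real_derivative f') (at t)" "0 < f t"
  shows "((\<lambda>t. xlnx (f t)) has_real_derivative (ln (f t) + 1) * f') (at t)"
  unfolding xlnx_def using assms
  by (auto intro!: derivative_eq_intros simp: algebra_simps)

text \<open>Strict convexity of \<open>xlnx\<close> in difference form: the increment has the
  positive derivative \<open>ln (t + 1) - ln t\<close>.\<close>

lemma xlnx_increment_less:
  assumes "0 < x" "x < y"
  shows "xlnx (x + 1) - xlnx x < xlnx (y + 1) - xlnx y"
proof -
  have "\<exists>l. ((\<lambda>x. xlnx (x + 1) - xlnx x) has_real_derivative l) (at t) \<and> 0 < l"
    if "x \<le> t" "t \<le> y" for t
    using that assms
    by (intro exI[of _ "ln (t + 1) - ln t"])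
       (auto intro!: derivative_eq_intros simp: field_simps)
  from DERIV_pos_imp_increasing[OF assms(2) this] show ?thesis by simp
qed

lemma ln_ge_one_minus_inverse: "0 < y \<Longrightarrow> 1 - 1 / y \<le> ln (y :: real)"
  using ln_le_minus_one[of "1 / y"] by (simp add: ln_div)

text \<open>The right-hand side is the tangent at \<open>x\<close> of the concave left-hand side; the inequality
  is the log sum inequality for the pairs \<open>(d + 1, x + 1)\<close> and \<open>(1, 1)\<close>.\<close>

lemma xlnx_increment_le_tangent:
  assumes "0 \<le> d" "0 \<le> x"
  shows "xlnx (d + 2) - xlnx (d + 1) \<le> (d + 2) * ln (x + 2) - (d + 1) * ln (x + 1)"
proof -
  \<comment> \<open>With these ratios the claim reads \<open>0 <= (d + 1) * ln y + ln z\<close>. The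
    bound \<open>1 - 1 / y <= ln y\<close> suffices, because the two lower bounds, with the same
    weights, add up to 0.\<close>
  define y where "y = (d + 1) * (x + 2) / ((x + 1) * (d + 2))"
  define z where "z = (x + 2) / (d + 2)"
  have yz: "0 < y" "0 < z" using assms by (auto simp: y_def z_def)
  have "(d + 1) * (1 - 1 / y) + (1 - 1 / z) = 0"
  proof -
    have "(d + 1) * (1 / y) = (x + 1) * (d + 2) / (x + 2)"
      using assms by (simp add: y_def divide_simps)
    moreover have "1 / z = (d + 2) / (x + 2)" by (simp add: z_def)
    moreover have "(x + 1) * (d + 2) / (x + 2) + (d + 2) / (x + 2) = d + 2"
      using assms by (simp add: flip: add_divide_distrib) (simp add: field_simps)
    ultimately show ?thesis by (simp add: algebra_simps)
  qed
  moreover have "(d + 1) * (1 - 1 / y) \<le> (d + 1) * ln y"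
    using ln_ge_one_minus_inverse[OF yz(1)] assms by (intro mult_left_mono) auto
  ultimately have "0 \<le> (d + 1) * ln y + ln z"
    using ln_ge_one_minus_inverse[OF yz(2)] by linarith
  moreover have "ln y = ln (d + 1) + ln (x + 2) - ln (x + 1) - ln (d + 2)"
    using assms by (simp add: y_def ln_div ln_mult)
  moreover have "ln z = ln (x + 2) - ln (d + 2)"
    using assms by (simp add: z_def ln_div)
  ultimately show ?thesis by (simp add: xlnx_def algebra_simps)
qed

text \<open>Jensen's inequality, by summing the tangent bound at \<open>2 * b / a\<close>, the
  largest mean that the bound on the sum allows. The tangent has positive slope, so an upper bound
  on the sum of \<open>d\<close> is enough. The right-hand side is \<open>a\<close> times the
  increment at that mean.\<close>

lemma sum_xlnx_increment_le:
  fixes d :: "'a \<Rightarrow> nat" and a b :: nat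
  assumes "finite S" "card S = a" "0 < a" "(\<Sum>v\<in>S. d v) \<le> 2 * b"
  shows "(\<Sum>v\<in>S. xlnx (real (d v) + 2) - xlnx (real (d v) + 1))
    \<le> 2 * xlnx (a + b) + 2 * (a + b) * ln 2 - xlnx (a + 2 * b) - xlnx a"
proof -
  define x where "x = 2 * real b / real a"
  define s where "s = real (\<Sum>v\<in>S. d v)"
  have x: "0 \<le> x" by (simp add: x_def)
  have s: "s \<le> 2 * real b" using assms(4) unfolding s_def by linarith
  have "(\<Sum>v\<in>S. xlnx (real (d v) + 2) - xlnx (real (d v) + 1))
      \<le> (\<Sum>v\<in>S. (real (d v) + 2) * ln (x + 2) - (real (d v) + 1) * ln (x + 1))"
    using x by (intro sum_mono xlnx_increment_le_tangent) auto
  also have "\<dots> = (s + 2 * a) * ln (x + 2) - (s + a) * ln (x + 1)"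
    using assms by (simp add: sum_subtractf sum.distrib flip: sum_distrib_right)
      (simp add: s_def algebra_simps)
  also have "\<dots> = s * (ln (x + 2) - ln (x + 1)) + 2 * a * ln (x + 2) - a * ln (x + 1)"
    by (simp add: algebra_simps)
  also have "\<dots> \<le> 2 * b * (ln (x + 2) - ln (x + 1)) + 2 * a * ln (x + 2) - a * ln (x + 1)"
    using s x by (intro diff_right_mono add_right_mono mult_right_mono) auto
  also have "ln (x + 2) = ln 2 + ln (a + b) - ln a"
  proof -
    have "x + 2 = 2 * (a + b) / a" using assms by (simp add: x_def field_simps)
    then have "ln (x + 2) = ln (2 * (real a + real b)) - ln a"
      using assms by (simp add: ln_div)
    also have "ln (2 * (real a + real b)) = ln 2 + ln (real a + real b)"
      using assms by (intro ln_mult_pos) auto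
    finally show ?thesis by simp
  qed
  also have "ln (x + 1) = ln (a + 2 * b) - ln a"
  proof -
    have "x + 1 = (a + 2 * b) / a" using assms by (simp add: x_def field_simps)
    then show ?thesis using assms by (simp add: ln_div)
  qed
  finally show ?thesis by (simp add: xlnx_def algebra_simps)
qed

text \<open>Deleting a vertex of degree \<open>a\<close> from a graph with \<open>a + b\<close> edges shows that the star
  wins by at least this amount, provided that it also wins among the graphs with \<open>b\<close> edges.\<close>

definition star_margin :: "real \<Rightarrow> real \<Rightarrow> real" where
  "star_margin a b = xlnx (a + b + 1) - xlnx (a + 1) - xlnx (b + 1) - 2 * b * ln 2
     - 2 * xlnx (a + b) + xlnx a + xlnx (a + 2 * b)"

text \<open>The margin is 0 at \<open>b = 0\<close>. Its derivative in \<open>b\<close> is the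
  logarithm of a quotient whose numerator exceeds the denominator by
  \<open>a * (a * (a - 3) + (a - 4) * t)\<close>, which is positive for
  \<open>4 <= a\<close>.\<close>

lemma star_margin_pos:
  assumes "4 \<le> a" "0 < b"
  shows "0 < star_margin a b"
proof -
  have "\<exists>l. (star_margin a has_real_derivative l) (at t) \<and> 0 < l"
    if t: "0 \<le> t" "t \<le> b" for t
  proof -
    define l where "l = ln (a + t + 1) - ln (t + 1) - 2 * ln 2 - 2 * ln (a + t) + 2 * ln (a + 2 * t)"
    have "(star_margin a has_real_derivative l) (at t)"
      unfolding star_margin_def[abs_def] using t assms
      by (auto intro!: derivative_eq_intros simp: l_def algebra_simps)
    moreover have "0 < l"
    proof -
      have "0 < a * (a - 3) + (a - 4) * t"
        using t assms by (intro add_pos_nonneg mult_pos_pos mult_nonneg_nonneg) auto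
      then have "0 < a * (a * (a - 3) + (a - 4) * t)" using assms by simp
      moreover have "(a + t + 1) * (a + 2 * t)^2 - 4 * (t + 1) * (a + t)^2
          = a * (a * (a - 3) + (a - 4) * t)"
        by (simp add: power2_eq_square algebra_simps)
      ultimately have "4 * (t + 1) * (a + t)^2 < (a + t + 1) * (a + 2 * t)^2" by linarith
      then have "ln (2^2 * (t + 1) * (a + t)^2) < ln ((a + t + 1) * (a + 2 * t)^2)"
        using t assms by (subst ln_less_cancel_iff) auto
      moreover have "ln (2^2 * (t + 1) * (a + t)^2) = 2 * ln 2 + ln (t + 1) + 2 * ln (a + t)"
        using t assms ln_mult_pos[of 4 "t + 1"] ln_realpow[of 2 2]
        by (simp add: ln_mult ln_realpow)
      ultimately show ?thesis using t assms by (simp add: l_def ln_mult ln_realpow)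
    qed
    ultimately show ?thesis by blast
  qed
  from DERIV_pos_imp_increasing[OF assms(2) this]
  show ?thesis by (simp add: star_margin_def)
qed

text \<open>Reduces the exceptional values of \<open>b\<close> to \<open>a = 4\<close>. The
  derivative in \<open>a\<close> is again the logarithm of a quotient; numerator minus denominator
  is \<open>b * (t * t + t * b - b)\<close>, nonnegative for \<open>1 <= t\<close>.\<close>

lemma star_margin_mono:
  assumes "1 \<le> a" "a \<le> a'" "0 \<le> b"
  shows "star_margin a b \<le> star_margin a' b"
proof -
  have "\<exists>l. ((\<lambda>a. star_margin a b) has_real_derivative l) (at t) \<and> 0 \<le> l"
    if t: "a \<le> t" "t \<le> a'" for t
  proof -
    define l where "l = ln (t + b + 1) - ln (t + 1) - 2 * ln (t + b) + ln t + ln (t + 2 * b)"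
    have "((\<lambda>a. star_margin a b) has_real_derivative l) (at t)"
      unfolding star_margin_def[abs_def] using t assms
      by (auto intro!: derivative_eq_intros simp: l_def algebra_simps)
    moreover have "0 \<le> l"
    proof -
      have pos: "0 < t" using t assms by simp
      have "(t + b + 1) * t * (t + 2 * b) - (t + 1) * (t + b)^2 = b * (t * t + t * b - b)"
        by (simp add: power2_eq_square algebra_simps)
      moreover have "0 \<le> b * (t * t + t * b - b)"
        using t assms mult_right_mono[of 1 t b] pos
        by (intro mult_nonneg_nonneg) (auto intro: add_increasing)
      ultimately have "(t + 1) * (t + b)^2 \<le> (t + b + 1) * t * (t + 2 * b)" by linarith
      then have "ln ((t + 1) * (t + b)^2) \<le> ln ((t + b + 1) * t * (t + 2 * b))"
        using pos assms by (subst ln_le_cancel_iff) auto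
      then show ?thesis using pos assms by (simp add: l_def ln_mult ln_realpow)
    qed
    ultimately show ?thesis by blast
  qed
  from DERIV_nonneg_imp_nondecreasing[OF assms(2) this]
  show ?thesis by simp
qed

text \<open>Turns a comparison of combinations of logarithms of integers into one of integers, which
  the simplifier decides. Bases 1 and exponents 0 fill the places that a comparison leaves
  empty.\<close>

lemma ln_lincomb_less:
  fixes a b c d :: real
  assumes "0 < a" "0 < b" "0 < c" "0 < d" "a ^ i * b ^ j < c ^ k * d ^ l"
  shows "real i * ln a + real j * ln b < real k * ln c + real l * ln d"
proof -
  have "ln (a ^ i * b ^ j) < ln (c ^ k * d ^ l)"
    using assms by (subst ln_less_cancel_iff) auto
  then show ?thesis using assms by (simp add: ln_mult ln_realpow)
qed

lemma xlnx_numerals: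
  "xlnx 2 = 2 * ln 2" "xlnx 3 = 3 * ln 3" "xlnx 4 = 8 * ln 2" "xlnx 5 = 5 * ln 5"
  "xlnx 6 = 6 * ln 2 + 6 * ln 3" "xlnx 7 = 7 * ln 7" "xlnx 8 = 24 * ln 2"
  "xlnx 10 = 10 * ln 2 + 10 * ln 5" "xlnx 11 = 11 * ln 11" "xlnx 16 = 64 * ln 2"
  using ln_realpow[of 2 2] ln_realpow[of 2 3] ln_realpow[of 2 4] ln_mult_pos[of 2 3]
    ln_mult_pos[of 2 5]
  by (simp_all add: xlnx_def)

text \<open>The exceptional values are those of K_3 and K_4; the generic one belongs to the star
  and, for \<open>k = 0\<close>, to the edgeless graph. There is no exception at 5, where K_4 minus
  an edge ties with the star: both give \<open>16 * ln 2 + 6 * ln 3\<close>.\<close>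

definition max_h1 :: "nat \<Rightarrow> real" where
  "max_h1 k = (if k = 3 then 9 * ln 3 else if k = 6 then 32 * ln 2
     else xlnx (real k + 1) + 2 * real k * ln 2)"

lemma star_less_max_h1:
  "xlnx 4 + 6 * ln 2 < max_h1 3" "xlnx 7 + 12 * ln 2 < max_h1 6"
  using ln_lincomb_less[of 2 1 3 1 14 0 9 0] ln_lincomb_less[of 7 1 2 1 7 0 20 0]
  by (simp_all add: max_h1_def xlnx_numerals)

text \<open>The left-hand side is the lead of \<open>max_h1 b\<close> over the star with
  \<open>b\<close> edges. It is 0 unless \<open>b\<close> is 3 or 6, where monotonicity in
  \<open>a\<close> leaves a numerical check at \<open>a = 4\<close>.\<close>

lemma max_h1_margin:
  fixes a b :: nat
  assumes "4 \<le> a" "1 \<le> b"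
  shows "max_h1 b - xlnx (real b + 1) - 2 * real b * ln 2 < star_margin a b"
proof (cases "b = 3 \<or> b = 6")
  case True
  then show ?thesis
  proof
    assume b: "b = 3"
    have "9 * ln 3 - 14 * ln 2 < star_margin 4 3"
      using ln_lincomb_less[of 3 7 2 5 9 14 42 5]
      by (simp add: star_margin_def xlnx_numerals ln_mult)
    also have "\<dots> \<le> star_margin a 3" using assms by (intro star_margin_mono) auto
    finally show ?thesis by (simp add: b max_h1_def xlnx_numerals)
  next
    assume b: "b = 6"
    have "20 * ln 2 - 7 * ln 7 < star_margin 4 6"
      using ln_lincomb_less[of 5 1 11 2 25 0 11 20]
      by (simp add: star_margin_def xlnx_numerals)
    also have "\<dots> \<le> star_margin a 6" using assms by (intro star_margin_mono) auto
    finally show ?thesis by (simp add: b max_h1_def xlnx_numerals)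
  qed
next
  case False
  then show ?thesis using star_margin_pos[of a b] assms by (simp add: max_h1_def)
qed

text \<open>The left-hand side is the chord bound on \<open>h1\<close> for degrees at most 3. From
  10 edges on, \<open>2^10 < 11^3\<close> suffices even after dropping one summand
  \<open>ln (k + 1)\<close>; 7 and 8 use \<open>8 <= k + 1\<close>, and 9 is computed.\<close>

lemma star_gt_chord3:
  fixes k :: nat
  assumes "7 \<le> k"
  shows "16 / 3 * real k * ln 2 < xlnx (real k + 1) + 2 * real k * ln 2"
proof -
  consider "10 \<le> k" | "k = 9" | "k < 9" by linarith
  then show ?thesis
  proof cases
    case 1
    have "10 * ln 2 < 3 * ln (11::real)"
      using ln_lincomb_less[of 2 1 11 1 10 0 3 0] by simp
    also have "ln (11::real) \<le> ln (real k + 1)" using 1 by (subst ln_le_cancel_iff) auto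
    finally have *: "10 / 3 * ln 2 < ln (real k + 1)" by simp
    have "10 / 3 * k * ln 2 < k * ln (real k + 1)" using * 1 by simp
    also have "\<dots> \<le> (real k + 1) * ln (real k + 1)" by (simp add: algebra_simps)
    finally show ?thesis by (simp add: xlnx_def algebra_simps)
  next
    case 2
    then show ?thesis using ln_lincomb_less[of 2 1 5 1 2 0 1 0] by (simp add: xlnx_numerals)
  next
    case 3
    have "3 * ln 2 \<le> ln (real k + 1)"
    proof -
      have "ln (2^3) \<le> ln (real k + 1)" using assms by (subst ln_le_cancel_iff) auto
      also have "ln (2^3) = 3 * ln (2::real)" using ln_realpow[of 2 3] by simp
      finally show ?thesis by simp
    qed
    then have "(real k + 1) * (3 * ln 2) \<le> (real k + 1) * ln (real k + 1)" by (intro mult_left_mono) auto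
    moreover have "10 / 3 * k * ln 2 < (real k + 1) * (3 * ln (2::real))"
      using 3 by (simp add: field_simps)
    ultimately have "10 / 3 * k * ln 2 < xlnx (real k + 1)" unfolding xlnx_def by linarith
    then show ?thesis by (simp add: algebra_simps)
  qed
qed

subsection \<open>Edge sets and the function \<open>h1\<close>\<close>

text \<open>Edges are kept in both orientations, as in \<open>arcs_ends\<close>, so
  \<open>card E\<close> is twice the number of edges.\<close>

definition simple_edges :: "('a \<times> 'a) set \<Rightarrow> bool" where
  "simple_edges E \<longleftrightarrow> finite E \<and> sym E \<and> irrefl E"

definition edge_degree :: "('a \<times> 'a) set \<Rightarrow> 'a \<Rightarrow> nat" where
  "edge_degree E v = card (E `` {v})"

definition delete_vertex :: "('a \<times> 'a) set \<Rightarrow> 'a \<Rightarrow> ('a \<times> 'a) set" where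
  "delete_vertex E v = {(x, y) \<in> E. x \<noteq> v \<and> y \<noteq> v}"

text \<open>Isolated vertices would contribute \<open>xlnx 1 = 0\<close>, so no vertex set has to be
  supplied.\<close>

definition edges_h1 :: "('a \<times> 'a) set \<Rightarrow> real" where
  "edges_h1 E = (\<Sum>v\<in>Domain E. xlnx (real (edge_degree E v) + 1))"

lemma finite_edge_Image: "finite E \<Longrightarrow> finite (E `` {v})"
  by (rule finite_subset[of _ "Range E"]) (auto simp: finite_Range)

lemma edge_degree_eq_0_iff: "finite E \<Longrightarrow> edge_degree E v = 0 \<longleftrightarrow> v \<notin> Domain E"
  by (auto simp: edge_degree_def finite_edge_Image)

lemma simple_edges_delete_vertex: "simple_edges E \<Longrightarrow> simple_edges (delete_vertex E v)"
  unfolding simple_edges_def delete_vertex_def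
  by (auto simp: sym_def irrefl_def elim: rev_finite_subset)

lemma edges_h1_superset:
  assumes "finite E" "finite V" "Domain E \<subseteq> V"
  shows "edges_h1 E = (\<Sum>v\<in>V. xlnx (real (edge_degree E v) + 1))"
  unfolding edges_h1_def
proof (rule sum.mono_neutral_left)
  show "\<forall>v\<in>V - Domain E. xlnx (real (edge_degree E v) + 1) = 0"
    using edge_degree_eq_0_iff[OF assms(1)] by (metis DiffD2 add_0 of_nat_0 xlnx_1)
qed (use assms in auto)

text \<open>The handshake lemma; its factor 2 is already contained in \<open>card E\<close>, which
  counts ordered pairs.\<close>

lemma sum_edge_degree:
  assumes "finite E" "finite V" "Domain E \<subseteq> V"
  shows "(\<Sum>v\<in>V. edge_degree E v) = card E"
proof -
  have "card E = card (SIGMA v:V. E `` {v})"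
    using assms by (intro arg_cong[of _ _ card]) auto
  also have "\<dots> = (\<Sum>v\<in>V. edge_degree E v)"
    using assms by (simp add: edge_degree_def finite_edge_Image)
  finally show ?thesis by simp
qed

lemma edge_degree_delete_vertex:
  assumes "simple_edges E" "u \<noteq> v"
  shows "edge_degree E u = edge_degree (delete_vertex E v) u + (if (v, u) \<in> E then 1 else 0)"
proof -
  have "delete_vertex E v `` {u} = E `` {u} - {v}"
    using assms by (auto simp: delete_vertex_def)
  moreover have "v \<in> E `` {u} \<longleftrightarrow> (v, u) \<in> E"
    using assms by (auto simp: simple_edges_def sym_def)
  moreover have "finite (E `` {u})"
    using assms by (simp add: simple_edges_def finite_edge_Image)
  ultimately show ?thesis
    using card_Suc_Diff1[of "E `` {u}" v] by (cases "(v, u) \<in> E") (simp_all add: edge_degree_def)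
qed

lemma card_delete_vertex:
  assumes "simple_edges E"
  shows "card E = card (delete_vertex E v) + 2 * edge_degree E v"
proof -
  have fin: "finite E" and irr: "(v, v) \<notin> E" and fI: "finite (E `` {v})"
    using assms by (auto simp: simple_edges_def irrefl_def finite_edge_Image)
  have "E = delete_vertex E v \<union> ({v} \<times> E `` {v} \<union> E `` {v} \<times> {v})"
    using assms by (auto simp: delete_vertex_def simple_edges_def sym_def)
  then have "card E = card (delete_vertex E v \<union> ({v} \<times> E `` {v} \<union> E `` {v} \<times> {v}))"
    by (rule arg_cong)
  also have "\<dots> = card (delete_vertex E v) + (card ({v} \<times> E `` {v}) + card (E `` {v} \<times> {v}))"
  proof -
    have "card ({v} \<times> E `` {v} \<union> E `` {v} \<times> {v})
        = card ({v} \<times> E `` {v}) + card (E `` {v} \<times> {v})"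
      using irr fI by (intro card_Un_disjoint) auto
    moreover have "finite (delete_vertex E v)"
      using fin by (rule rev_finite_subset) (auto simp: delete_vertex_def)
    ultimately show ?thesis
      using fI by (subst card_Un_disjoint) (auto simp: delete_vertex_def)
  qed
  finally show ?thesis by (simp add: edge_degree_def card_cartesian_product)
qed

text \<open>Deleting \<open>v\<close> lowers the degrees of exactly its neighbours, each by one.
  Expressing the loss through the retained degrees \<open>d'\<close> produces the concave increments
  that Jensen's inequality bounds.\<close>

lemma edges_h1_delete_vertex:
  fixes v :: 'a
  assumes "simple_edges E"
  defines "d' \<equiv> \<lambda>u. real (edge_degree (delete_vertex E v) u)"
  shows "edges_h1 E = xlnx (real (edge_degree E v) + 1)
    + (\<Sum>u\<in>E `` {v}. xlnx (d' u + 2) - xlnx (d' u + 1)) + edges_h1 (delete_vertex E v)"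
proof -
  define V where "V = insert v (Domain E)"
  have fin: "finite E" "finite V" and dom: "Domain E \<subseteq> V"
    using assms by (auto simp: simple_edges_def V_def finite_Domain)
  have nb: "E `` {v} \<subseteq> V - {v}"
    using assms by (auto simp: simple_edges_def sym_def irrefl_def V_def)
  have "edges_h1 E = xlnx (real (edge_degree E v) + 1)
      + (\<Sum>u\<in>V - {v}. xlnx (real (edge_degree E u) + 1))"
    using fin dom by (subst edges_h1_superset[of _ V], simp_all)
      (subst sum.remove[of _ v], auto simp: V_def)
  also have "(\<Sum>u\<in>V - {v}. xlnx (real (edge_degree E u) + 1))
      = (\<Sum>u\<in>V - {v}. (if u \<in> E `` {v} then xlnx (d' u + 2) - xlnx (d' u + 1) else 0) + xlnx (d' u + 1))"
    using assms(1) by (intro sum.cong) (auto simp: edge_degree_delete_vertex[of E _ v] d'_def add.commute)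
  also have "\<dots> = (\<Sum>u\<in>E `` {v}. xlnx (d' u + 2) - xlnx (d' u + 1)) + (\<Sum>u\<in>V - {v}. xlnx (d' u + 1))"
    using fin nb by (subst sum.distrib, subst sum.inter_restrict[symmetric]) (auto simp: Int_absorb1)
  also have "(\<Sum>u\<in>V - {v}. xlnx (d' u + 1)) = edges_h1 (delete_vertex E v)"
    unfolding d'_def using fin
    by (intro edges_h1_superset[symmetric])
       (auto simp: delete_vertex_def V_def intro: finite_subset[of _ E])
  finally show ?thesis by simp
qed

text \<open>A linear bound on the summands turns into a bound in terms of \<open>card E\<close> by
  the handshake lemma. A vertex with strict inequality cannot be isolated, since both sides are 0 at
  degree 0.\<close>

lemma edges_h1_le_chord:
  assumes "simple_edges E" "\<And>v. xlnx (real (edge_degree E v) + 1) \<le> c * real (edge_degree E v)"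
  shows "edges_h1 E \<le> c * card E"
    and "xlnx (real (edge_degree E u) + 1) < c * real (edge_degree E u) \<Longrightarrow> edges_h1 E < c * card E"
proof -
  have fin: "finite E" "finite (Domain E)"
    using assms by (auto simp: simple_edges_def finite_Domain)
  have eq: "(\<Sum>v\<in>Domain E. c * real (edge_degree E v)) = c * card E"
    using sum_edge_degree[OF fin order_refl] by (simp flip: sum_distrib_left of_nat_sum)
  show "edges_h1 E \<le> c * card E"
    unfolding edges_h1_def eq[symmetric] by (intro sum_mono assms)
  assume less: "xlnx (real (edge_degree E u) + 1) < c * real (edge_degree E u)"
  then have "u \<in> Domain E" using edge_degree_eq_0_iff[OF fin(1), of u] by (cases "u \<in> Domain E") auto
  then show "edges_h1 E < c * card E"
    unfolding edges_h1_def eq[symmetric] by (intro sum_strict_mono_ex1) (use assms less fin in auto)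
qed

text \<open>This and the next three definitions restate the parts of \<open>extremal_shape\<close>
  for edge sets. As no vertex set occurs in them, deleting isolated vertices is built in.\<close>

definition edges_star :: "nat \<Rightarrow> ('a \<times> 'a) set \<Rightarrow> bool" where
  "edges_star k E \<longleftrightarrow> (\<exists>c L. c \<notin> L \<and> finite L \<and> card L = k \<and> E = {c} \<times> L \<union> L \<times> {c})"

definition edges_complete :: "nat \<Rightarrow> ('a \<times> 'a) set \<Rightarrow> bool" where
  "edges_complete j E \<longleftrightarrow> (\<exists>S. finite S \<and> card S = j \<and> E = {(x, y). x \<in> S \<and> y \<in> S \<and> x \<noteq> y})"

definition edges_K4_minus :: "('a \<times> 'a) set \<Rightarrow> bool" where
  "edges_K4_minus E \<longleftrightarrow> (\<exists>S u v. card S = 4 \<and> u \<in> S \<and> v \<in> S \<and> u \<noteq> v \<and>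
     E = {(x, y). x \<in> S \<and> y \<in> S \<and> x \<noteq> y} - {(u, v), (v, u)})"

definition edges_extremal :: "nat \<Rightarrow> ('a \<times> 'a) set \<Rightarrow> bool" where
  "edges_extremal k E \<longleftrightarrow>
     (k = 0 \<longrightarrow> E = {}) \<and>
     (1 \<le> k \<and> k \<notin> {3, 5, 6} \<longrightarrow> edges_star k E) \<and>
     (k = 3 \<longrightarrow> edges_complete 3 E) \<and>
     (k = 5 \<longrightarrow> edges_K4_minus E \<or> edges_star 5 E) \<and>
     (k = 6 \<longrightarrow> edges_complete 4 E)"

text \<open>All edges meet \<open>v\<close>. This is the base case \<open>b = 0\<close> of the
  induction, and it also yields the value of \<open>h1\<close> for stars.\<close>

lemma edges_star_if_delete_vertex_empty:
  assumes "simple_edges E" "delete_vertex E v = {}"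
  shows "edges_star (edge_degree E v) E"
    and "edges_h1 E = xlnx (real (edge_degree E v) + 1) + 2 * real (edge_degree E v) * ln 2"
proof -
  have "E = {v} \<times> E `` {v} \<union> E `` {v} \<times> {v}"
    using assms by (auto simp: delete_vertex_def simple_edges_def sym_def)
  moreover have "v \<notin> E `` {v}" "finite (E `` {v})"
    using assms by (auto simp: simple_edges_def irrefl_def finite_edge_Image)
  ultimately show "edges_star (edge_degree E v) E"
    unfolding edges_star_def edge_degree_def by blast
  show "edges_h1 E = xlnx (real (edge_degree E v) + 1) + 2 * real (edge_degree E v) * ln 2"
    using assms by (subst edges_h1_delete_vertex[of E v])
      (simp_all add: edges_h1_def xlnx_numerals, simp add: edge_degree_def xlnx_numerals)
qed

lemma edges_h1_star:
  assumes "edges_star k E"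
  shows "edges_h1 E = xlnx (real k + 1) + 2 * real k * ln 2"
proof -
  from assms obtain c L where cL: "c \<notin> L" "finite L" "card L = k" "E = {c} \<times> L \<union> L \<times> {c}"
    unfolding edges_star_def by blast
  then have "simple_edges E" "delete_vertex E c = {}"
    by (auto simp: simple_edges_def sym_def irrefl_def delete_vertex_def)
  moreover have "E `` {c} = L" using cL by auto
  then have "edge_degree E c = k" using cL by (simp add: edge_degree_def)
  ultimately show ?thesis using edges_star_if_delete_vertex_empty(2)[of E c] by simp
qed

lemma edges_h1_complete:
  assumes "edges_complete j E"
  shows "edges_h1 E = j * xlnx j"
proof -
  from assms obtain S where S: "finite S" "card S = j" "E = {(x, y). x \<in> S \<and> y \<in> S \<and> x \<noteq> y}"
    unfolding edges_complete_def by blast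
  have "finite E" by (rule finite_subset[of _ "S \<times> S"]) (use S in auto)
  then have "edges_h1 E = (\<Sum>v\<in>S. xlnx (real (edge_degree E v) + 1))"
    using S by (intro edges_h1_superset) auto
  also have "\<dots> = (\<Sum>v\<in>S. xlnx j)"
  proof (intro sum.cong refl)
    fix v assume v: "v \<in> S"
    then have "E `` {v} = S - {v}" using S by auto
    moreover have "card S \<noteq> 0" using v S by auto
    ultimately show "xlnx (real (edge_degree E v) + 1) = xlnx j"
      using S v by (simp add: edge_degree_def of_nat_diff)
  qed
  finally show ?thesis using S by simp
qed

lemma edges_h1_K4_minus:
  assumes "edges_K4_minus E"
  shows "edges_h1 E = 16 * ln 2 + 6 * ln 3"
proof -
  from assms obtain S u v where S: "card S = 4" and uv: "u \<in> S" "v \<in> S" "u \<noteq> v"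
    and E: "E = {(x, y). x \<in> S \<and> y \<in> S \<and> x \<noteq> y} - {(u, v), (v, u)}"
    unfolding edges_K4_minus_def by blast
  have fS: "finite S" using S card.infinite by force
  have "finite E" by (rule finite_subset[of _ "S \<times> S"]) (use fS E in auto)
  then have "edges_h1 E = (\<Sum>w\<in>S. xlnx (real (edge_degree E w) + 1))"
    using fS E by (intro edges_h1_superset) auto
  also have "\<dots> = (\<Sum>w\<in>S. if w \<in> {u, v} then xlnx 3 else xlnx 4)"
  proof (intro sum.cong refl)
    fix w assume w: "w \<in> S"
    have "E `` {w} = (if w \<in> {u, v} then S - {u, v} else S - {w})" using E w by auto
    then have "edge_degree E w = (if w \<in> {u, v} then 2 else 3)"
      using fS S uv w by (auto simp: edge_degree_def card_Diff_subset)
    then show "xlnx (real (edge_degree E w) + 1) = (if w \<in> {u, v} then xlnx 3 else xlnx 4)" by simp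
  qed
  also have "\<dots> = (\<Sum>w\<in>{u, v}. xlnx 3) + (\<Sum>w\<in>S - {u, v}. xlnx 4)"
    using fS uv by (subst sum.subset_diff[of "{u, v}" S]) (auto simp: add.commute)
  also have "\<dots> = 16 * ln 2 + 6 * ln 3"
    using S fS uv by (simp add: card_Diff_subset xlnx_numerals)
  finally show ?thesis .
qed

text \<open>The converse of the equality case in \<open>edges_h1_le_max_h1\<close>; in particular
  both shapes allowed for \<open>k = 5\<close> attain the maximum.\<close>

lemma edges_h1_extremal:
  assumes "edges_extremal k E"
  shows "edges_h1 E = max_h1 k"
proof -
  consider "k = 0" | "k = 3" | "k = 5" | "k = 6" | "1 \<le> k" "k \<notin> {3, 5, 6}" by fastforce
  then show ?thesis
  proof cases
    case 1
    then show ?thesis using assms by (simp add: edges_extremal_def max_h1_def edges_h1_def)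
  next
    case 2
    then show ?thesis
      using assms edges_h1_complete[of 3 E]
      by (simp add: edges_extremal_def max_h1_def xlnx_numerals)
  next
    case 3
    then show ?thesis
      using assms edges_h1_star[of 5 E] edges_h1_K4_minus[of E]
      by (auto simp: edges_extremal_def max_h1_def xlnx_numerals)
  next
    case 4
    then show ?thesis
      using assms edges_h1_complete[of 4 E]
      by (simp add: edges_extremal_def max_h1_def xlnx_numerals)
  next
    case 5
    then show ?thesis
      using assms edges_h1_star[of k E] by (simp add: edges_extremal_def max_h1_def)
  qed
qed

subsection \<open>The maximum of \<open>h1\<close>\<close>

lemma star_le_max_h1: "xlnx (real k + 1) + 2 * real k * ln 2 \<le> max_h1 k"
  using star_less_max_h1 by (cases "k = 3"; cases "k = 6") (auto simp: max_h1_def)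

lemma sum_edge_degree_le:
  assumes "finite E" "finite S"
  shows "(\<Sum>v\<in>S. edge_degree E v) \<le> card E"
proof -
  have "(\<Sum>v\<in>S. edge_degree E v) \<le> (\<Sum>v\<in>S \<union> Domain E. edge_degree E v)"
    using assms by (intro sum_mono2) (auto simp: finite_Domain)
  also have "\<dots> = card E" using assms by (intro sum_edge_degree) (auto simp: finite_Domain)
  finally show ?thesis .
qed

lemma edge_degree_le_half: "simple_edges E \<Longrightarrow> card E = 2 * k \<Longrightarrow> edge_degree E v \<le> k"
  using card_delete_vertex[of E v] by linarith

lemma ex_max_edge_degree:
  assumes "finite E" "E \<noteq> {}"
  obtains v where "\<And>u. edge_degree E u \<le> edge_degree E v" "1 \<le> edge_degree E v"
proof -
  have fD: "finite (Domain E)" "Domain E \<noteq> {}" using assms by (auto simp: finite_Domain)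
  then have "Max (edge_degree E ` Domain E) \<in> edge_degree E ` Domain E" by (intro Max_in) auto
  then obtain v where "v \<in> Domain E" "edge_degree E v = Max (edge_degree E ` Domain E)" by force
  with fD have v: "v \<in> Domain E" "\<And>u. u \<in> Domain E \<Longrightarrow> edge_degree E u \<le> edge_degree E v"
    by simp_all
  show ?thesis
  proof (rule that[of v])
    show "edge_degree E u \<le> edge_degree E v" for u
      using v edge_degree_eq_0_iff[OF assms(1), of u] by (cases "u \<in> Domain E") auto
    show "1 \<le> edge_degree E v"
      using v edge_degree_eq_0_iff[OF assms(1), of v] by (simp add: Suc_le_eq)
  qed
qed

text \<open>The neighbours of \<open>v\<close> retain total degree at most \<open>2 * b\<close>, so
  Jensen's inequality bounds their contribution. The margin then absorbs whatever the remaining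
  graph may gain over the star. Strictness means that no equality case arises here.\<close>

lemma edges_h1_less_if_large_degree:
  assumes E: "simple_edges E" "card (delete_vertex E v) = 2 * b"
    and deg: "edge_degree E v = a" "4 \<le> a" "1 \<le> b"
    and IH: "edges_h1 (delete_vertex E v) \<le> max_h1 b"
  shows "edges_h1 E < max_h1 (a + b)"
proof -
  have fin: "finite (E `` {v})" "finite (delete_vertex E v)"
    using E(1) simple_edges_delete_vertex[OF E(1)] by (auto simp: simple_edges_def finite_edge_Image)
  define T where "T = (\<Sum>u\<in>E `` {v}. xlnx (real (edge_degree (delete_vertex E v) u) + 2)
      - xlnx (real (edge_degree (delete_vertex E v) u) + 1))"
  have "T \<le> 2 * xlnx (a + b) + 2 * (a + b) * ln 2 - xlnx (a + 2 * b) - xlnx a"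
    unfolding T_def using deg sum_edge_degree_le[OF fin(2,1)] E(2) fin
    by (intro sum_xlnx_increment_le) (auto simp: edge_degree_def)
  moreover have "edges_h1 E = xlnx (real a + 1) + T + edges_h1 (delete_vertex E v)"
    unfolding T_def using edges_h1_delete_vertex[OF E(1), of v] deg by simp
  moreover note max_h1_margin[OF deg(2,3)] IH
  ultimately have "edges_h1 E < xlnx (real (a + b) + 1) + 2 * real (a + b) * ln 2"
    by (simp add: star_margin_def algebra_simps)
  then show ?thesis using star_le_max_h1[of "a + b"] by linarith
qed

text \<open>By the handshake lemma there are \<open>j + 1\<close> non-isolated vertices, so a vertex
  with \<open>j\<close> neighbours is adjacent to all others.\<close>

lemma edges_complete_if_regular:
  assumes "simple_edges E" "\<And>v. v \<in> Domain E \<Longrightarrow> edge_degree E v = j"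
    and "card E = (j + 1) * j" "1 \<le> j"
  shows "edges_complete (j + 1) E"
proof -
  have fin: "finite E" "finite (Domain E)" using assms by (auto simp: simple_edges_def finite_Domain)
  have "card E = (\<Sum>v\<in>Domain E. j)"
    using sum_edge_degree[OF fin order_refl] assms(2) by simp
  then have "(j + 1) * j = card (Domain E) * j" using assms(3) by simp
  then have card: "card (Domain E) = j + 1" using assms(4) mult_cancel2[of "j + 1" j] by simp
  have "E `` {v} = Domain E - {v}" if v: "v \<in> Domain E" for v
  proof (rule card_subset_eq)
    show "E `` {v} \<subseteq> Domain E - {v}"
      using assms(1) by (auto simp: simple_edges_def sym_def irrefl_def)
    show "card (E `` {v}) = card (Domain E - {v})"
      using v assms(2) card fin by (simp add: edge_degree_def)
  qed (use fin in auto)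
  then have "(x, y) \<in> E \<longleftrightarrow> x \<in> Domain E \<and> y \<in> Domain E \<and> x \<noteq> y" for x y
    by blast
  then have "E = {(x, y). x \<in> Domain E \<and> y \<in> Domain E \<and> x \<noteq> y}" by auto
  then show ?thesis unfolding edges_complete_def using card fin by blast
qed

text \<open>This and the next two lemmas bound the convex function \<open>xlnx (d + 1)\<close> on
  \<open>d <= N\<close>, for \<open>N\<close> equal to 1, 2, 3, by its chord from
  \<open>d = 0\<close> to \<open>d = N\<close>. The inequality is strict strictly between the
  endpoints, which later forces regularity in the equality cases.\<close>

lemma xlnx_le_chord1:
  "d \<le> 1 \<Longrightarrow> xlnx (real d + 1) \<le> 2 * ln 2 * real d"
  by (cases d) (auto simp: xlnx_numerals)

lemma xlnx_le_chord2:
  assumes "d \<le> 2"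
  shows "xlnx (real d + 1) \<le> 3 / 2 * ln 3 * real d"
    and "d = 1 \<Longrightarrow> xlnx (real d + 1) < 3 / 2 * ln 3 * real d"
proof -
  have "d \<in> {0, 1, 2}" using assms by auto
  moreover have "4 * ln 2 < 3 * ln (3::real)" using ln_lincomb_less[of 2 1 3 1 4 0 3 0] by simp
  ultimately show "xlnx (real d + 1) \<le> 3 / 2 * ln 3 * real d"
    "d = 1 \<Longrightarrow> xlnx (real d + 1) < 3 / 2 * ln 3 * real d"
    by (auto simp: xlnx_numerals)
qed

lemma xlnx_le_chord3:
  assumes "d \<le> 3"
  shows "xlnx (real d + 1) \<le> 8 / 3 * ln 2 * real d"
    and "d = 1 \<or> d = 2 \<Longrightarrow> xlnx (real d + 1) < 8 / 3 * ln 2 * real d"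
proof -
  have "d \<in> {0, 1, 2, 3}" using assms by auto
  moreover have "9 * ln 3 < 16 * ln (2::real)" using ln_lincomb_less[of 3 1 2 1 9 0 16 0] by simp
  ultimately show "xlnx (real d + 1) \<le> 8 / 3 * ln 2 * real d"
    "d = 1 \<or> d = 2 \<Longrightarrow> xlnx (real d + 1) < 8 / 3 * ln 2 * real d"
    by (auto simp: xlnx_numerals)
qed

text \<open>For 4 edges the chord bound for degrees at most 3 lies above the star. After deleting a
  vertex of degree 3, however, one edge remains, so the retained degrees are only 0 or 1.\<close>

lemma edges_h1_four_edges:
  assumes E: "simple_edges E" "card (delete_vertex E v) = 2" "edge_degree E v = 3"
    and IH: "edges_h1 (delete_vertex E v) \<le> max_h1 1"
  shows "edges_h1 E < max_h1 4"
proof -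
  define d' where "d' = edge_degree (delete_vertex E v)"
  have S: "simple_edges (delete_vertex E v)" by (rule simple_edges_delete_vertex[OF E(1)])
  have fin: "finite (E `` {v})" "finite (delete_vertex E v)"
    using E(1) S by (auto simp: simple_edges_def finite_edge_Image)
  have c: "3 * ln 3 > 4 * ln (2::real)" using ln_lincomb_less[of 2 1 3 1 4 0 3 0] by simp
  \<comment> \<open>The linear function agrees with the increment at both possible values 0 and 1 of
    \<open>d' u\<close>.\<close>
  have "(\<Sum>u\<in>E `` {v}. xlnx (real (d' u) + 2) - xlnx (real (d' u) + 1))
      \<le> (\<Sum>u\<in>E `` {v}. 2 * ln 2 + real (d' u) * (3 * ln 3 - 4 * ln 2))"
  proof (intro sum_mono)
    fix u
    have "d' u \<le> 1" unfolding d'_def using edge_degree_le_half[OF S, of 1 u] E by simp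
    then have "d' u \<in> {0, 1}" by auto
    then show "xlnx (real (d' u) + 2) - xlnx (real (d' u) + 1)
        \<le> 2 * ln 2 + real (d' u) * (3 * ln 3 - 4 * ln 2)"
      by (auto simp: xlnx_numerals)
  qed
  also have "\<dots> = 6 * ln 2 + real (\<Sum>u\<in>E `` {v}. d' u) * (3 * ln 3 - 4 * ln 2)"
    using E(3) by (simp add: sum.distrib edge_degree_def flip: sum_distrib_right)
  also have "\<dots> \<le> 6 * ln 2 + 2 * (3 * ln 3 - 4 * ln 2)"
    using c sum_edge_degree_le[OF fin(2,1)] E(2)
    by (intro add_left_mono mult_right_mono) (auto simp: d'_def simp flip: of_nat_sum)
  finally have "edges_h1 E \<le> 10 * ln 2 + 6 * ln 3"
    using edges_h1_delete_vertex[OF E(1), of v] E(3) IH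
    by (simp add: d'_def max_h1_def xlnx_numerals)
  also have "\<dots> < max_h1 4"
    using ln_lincomb_less[of 2 3 5 1 2 6 5 0] by (simp add: max_h1_def xlnx_numerals)
  finally show ?thesis .
qed

text \<open>A star with two edges is a path \<open>p\<close>, \<open>c\<close>, \<open>q\<close>.
  Once \<open>v\<close> is joined to all three vertices, the only missing pair is that of the leaves
  \<open>p\<close> and \<open>q\<close>.\<close>

lemma edges_K4_minus_if_star_deleted:
  assumes E: "simple_edges E" and star: "edges_star 2 (delete_vertex E v)"
    and nb: "E `` {v} = Domain (delete_vertex E v)"
  shows "edges_K4_minus E"
proof -
  from star obtain c L where cL: "c \<notin> L" "card L = 2" "delete_vertex E v = {c} \<times> L \<union> L \<times> {c}"
    unfolding edges_star_def by blast
  then obtain p q where L: "L = {p, q}" "p \<noteq> q" by (meson card_2_iff)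
  have D: "delete_vertex E v = {(c, p), (c, q), (p, c), (q, c)}" using cL L by auto
  then have N: "E `` {v} = {c, p, q}" using nb by auto
  have v: "v \<notin> {c, p, q}" using N E by (auto simp: simple_edges_def irrefl_def)
  have "E = delete_vertex E v \<union> {v} \<times> E `` {v} \<union> E `` {v} \<times> {v}"
    using E by (auto simp: delete_vertex_def simple_edges_def sym_def)
  also have "\<dots> = {(x, y). x \<in> {v, c, p, q} \<and> y \<in> {v, c, p, q} \<and> x \<noteq> y} - {(p, q), (q, p)}"
    unfolding N unfolding D using v cL L by auto
  finally have "E = {(x, y). x \<in> {v, c, p, q} \<and> y \<in> {v, c, p, q} \<and> x \<noteq> y} - {(p, q), (q, p)}" .
  moreover have "card {v, c, p, q} = 4" using v cL L by auto
  ultimately show ?thesis unfolding edges_K4_minus_def using L(2) by blast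
qed

text \<open>Again the chord for degrees at most 3 is too weak. Two edges remain after deleting
  \<open>v\<close>, and the bound is sharp exactly when they form a path on the three neighbours of
  \<open>v\<close>; this is where K_4 minus an edge arises.\<close>

lemma edges_h1_five_edges:
  assumes E: "simple_edges E" "card (delete_vertex E v) = 4" "edge_degree E v = 3"
    and IH: "edges_h1 (delete_vertex E v) \<le> max_h1 2"
      "edges_h1 (delete_vertex E v) = max_h1 2 \<Longrightarrow> edges_star 2 (delete_vertex E v)"
  shows "edges_h1 E \<le> max_h1 5" and "edges_h1 E = max_h1 5 \<Longrightarrow> edges_K4_minus E"
proof -
  define d' where "d' = edge_degree (delete_vertex E v)"
  define s where "s = (\<Sum>u\<in>E `` {v}. d' u)"
  have S: "simple_edges (delete_vertex E v)" by (rule simple_edges_delete_vertex[OF E(1)])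
  have fin: "finite (E `` {v})" "finite (delete_vertex E v)"
    using E(1) S by (auto simp: simple_edges_def finite_edge_Image)
  have c: "6 * ln 3 < 10 * ln (2::real)" "14 * ln 2 < 9 * ln (3::real)"
    using ln_lincomb_less[of 3 1 2 1 6 0 10 0] ln_lincomb_less[of 2 1 3 1 14 0 9 0] by simp_all
  have s4: "s \<le> 4" using sum_edge_degree_le[OF fin(2,1)] E(2) by (simp add: s_def d'_def)
  \<comment> \<open>The line passes through the increments at 1 and 2, the degrees occurring in a
    path with two edges, and lies above the increment at 0.\<close>
  have "(\<Sum>u\<in>E `` {v}. xlnx (real (d' u) + 2) - xlnx (real (d' u) + 1))
      \<le> (\<Sum>u\<in>E `` {v}. (9 * ln 3 - 12 * ln 2) + real (d' u) * (10 * ln 2 - 6 * ln 3))"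
  proof (intro sum_mono)
    fix u
    have "d' u \<le> 2" unfolding d'_def using edge_degree_le_half[OF S, of 2 u] E by simp
    then have "d' u \<in> {0, 1, 2}" by auto
    then show "xlnx (real (d' u) + 2) - xlnx (real (d' u) + 1)
        \<le> (9 * ln 3 - 12 * ln 2) + real (d' u) * (10 * ln 2 - 6 * ln 3)"
      using c by (auto simp: xlnx_numerals)
  qed
  also have "\<dots> = 3 * (9 * ln 3 - 12 * ln 2) + real s * (10 * ln 2 - 6 * ln 3)"
    using E(3) by (simp add: sum.distrib edge_degree_def s_def flip: sum_distrib_right)
  finally have le: "edges_h1 E \<le> 3 * (9 * ln 3 - 12 * ln 2) + real s * (10 * ln 2 - 6 * ln 3)
      + 8 * ln 2 + edges_h1 (delete_vertex E v)"
    using edges_h1_delete_vertex[OF E(1), of v] E(3) by (simp add: d'_def xlnx_numerals)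
  have s_le: "real s * (10 * ln 2 - 6 * ln 3) \<le> 4 * (10 * ln 2 - 6 * ln 3)"
    using c s4 by (intro mult_right_mono) auto
  show "edges_h1 E \<le> max_h1 5"
    using le s_le IH(1) by (simp add: max_h1_def xlnx_numerals)
  assume eq: "edges_h1 E = max_h1 5"
  \<comment> \<open>The slope is positive, so equality forces the neighbours of \<open>v\<close> to
    carry the whole degree sum 4 of the remaining graph.\<close>
  have "s = 4"
  proof (rule ccontr)
    assume "s \<noteq> 4"
    then have "real s * (10 * ln 2 - 6 * ln 3) < 4 * (10 * ln 2 - 6 * ln 3)"
      using c s4 by (intro mult_strict_right_mono) auto
    then show False using le IH(1) eq by (simp add: max_h1_def xlnx_numerals)
  qed
  have star: "edges_star 2 (delete_vertex E v)"
    using le s_le IH(1) eq by (intro IH(2)) (simp add: max_h1_def xlnx_numerals)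
  \<comment> \<open>A non-isolated vertex outside the neighbourhood would raise the degree sum above
    4.\<close>
  have sub: "Domain (delete_vertex E v) \<subseteq> E `` {v}"
  proof (rule ccontr)
    assume "\<not> Domain (delete_vertex E v) \<subseteq> E `` {v}"
    then obtain w where w: "w \<in> Domain (delete_vertex E v)" "w \<notin> E `` {v}" by blast
    then have "d' w \<noteq> 0" using edge_degree_eq_0_iff[OF fin(2)] by (simp add: d'_def)
    moreover have "(\<Sum>u\<in>insert w (E `` {v}). d' u) \<le> 4"
      using sum_edge_degree_le[OF fin(2), of "insert w (E `` {v})"] fin E(2) by (simp add: d'_def)
    ultimately show False using w fin \<open>s = 4\<close> by (simp add: s_def)
  qed
  have "card (Domain (delete_vertex E v)) = 3"
  proof -
    from star obtain c L where cL: "c \<notin> L" "finite L" "card L = 2"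
      and D: "delete_vertex E v = {c} \<times> L \<union> L \<times> {c}"
      unfolding edges_star_def by blast
    have "L \<noteq> {}" using cL by auto
    then have "Domain (delete_vertex E v) = insert c L" unfolding D by auto
    then show ?thesis using cL by simp
  qed
  then have "Domain (delete_vertex E v) = E `` {v}"
    using sub fin E(3) by (intro card_subset_eq) (auto simp: edge_degree_def)
  then show "edges_K4_minus E" using edges_K4_minus_if_star_deleted[OF E(1) star] by simp
qed

text \<open>The chord bounds summed over a graph with degrees at most \<open>N\<close>. Equality
  leaves only degrees 0 and \<open>N\<close>; for \<open>N = 2\<close>, \<open>k = 3\<close> and for
  \<open>N = 3\<close>, \<open>k = 6\<close> the bound equals \<open>max_h1 k\<close>, and
  regularity identifies K_3 and K_4.\<close>

lemma edges_h1_le_small_degree: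
  assumes E: "simple_edges E" "card E = 2 * k" and deg: "\<And>u. edge_degree E u \<le> N"
  shows "N = 1 \<Longrightarrow> edges_h1 E \<le> 4 * real k * ln 2"
    and "N = 2 \<Longrightarrow> edges_h1 E \<le> 3 * real k * ln 3"
    and "N = 3 \<Longrightarrow> edges_h1 E \<le> 16 / 3 * real k * ln 2"
    and "N = 2 \<Longrightarrow> k = 3 \<Longrightarrow> edges_h1 E = 9 * ln 3 \<Longrightarrow> edges_complete 3 E"
    and "N = 3 \<Longrightarrow> k = 6 \<Longrightarrow> edges_h1 E = 32 * ln 2 \<Longrightarrow> edges_complete 4 E"
proof -
  have fin: "finite E" using E by (simp add: simple_edges_def)
  show "edges_h1 E \<le> 4 * real k * ln 2" if "N = 1"
  proof -
    have "edges_h1 E \<le> 2 * ln 2 * real (card E)"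
      using deg that by (intro edges_h1_le_chord(1)[OF E(1)] xlnx_le_chord1) auto
    then show ?thesis using E(2) by (simp add: mult_ac)
  qed
  show "edges_h1 E \<le> 3 * real k * ln 3" if "N = 2"
  proof -
    have "edges_h1 E \<le> 3 / 2 * ln 3 * real (card E)"
      using deg that by (intro edges_h1_le_chord(1)[OF E(1)] xlnx_le_chord2(1)) auto
    then show ?thesis using E(2) by (simp add: mult_ac)
  qed
  show "edges_h1 E \<le> 16 / 3 * real k * ln 2" if "N = 3"
  proof -
    have "edges_h1 E \<le> 8 / 3 * ln 2 * real (card E)"
      using deg that by (intro edges_h1_le_chord(1)[OF E(1)] xlnx_le_chord3(1)) auto
    then show ?thesis using E(2) by (simp add: mult_ac)
  qed
  show "edges_complete 3 E" if N: "N = 2" and k: "k = 3" and eq: "edges_h1 E = 9 * ln 3"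
  proof -
    have "edge_degree E v = 2" if v: "v \<in> Domain E" for v
    proof (rule ccontr)
      assume "edge_degree E v \<noteq> 2"
      then have "edge_degree E v = 1"
        using deg[of v] N v edge_degree_eq_0_iff[OF fin, of v] by linarith
      then have "xlnx (real (edge_degree E v) + 1) < 3 / 2 * ln 3 * real (edge_degree E v)"
        by (intro xlnx_le_chord2(2)) auto
      then have "edges_h1 E < 3 / 2 * ln 3 * card E"
        using deg N by (intro edges_h1_le_chord(2)[OF E(1)] xlnx_le_chord2(1)) auto
      then show False using E(2) k eq by simp
    qed
    then show ?thesis using edges_complete_if_regular[OF E(1), of 2] E(2) k by simp
  qed
  show "edges_complete 4 E" if N: "N = 3" and k: "k = 6" and eq: "edges_h1 E = 32 * ln 2"
  proof -
    have "edge_degree E v = 3" if v: "v \<in> Domain E" for v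
    proof (rule ccontr)
      assume "edge_degree E v \<noteq> 3"
      then have "edge_degree E v = 1 \<or> edge_degree E v = 2"
        using deg[of v] N v edge_degree_eq_0_iff[OF fin, of v] by linarith
      then have "xlnx (real (edge_degree E v) + 1) < 8 / 3 * ln 2 * real (edge_degree E v)"
        by (intro xlnx_le_chord3(2)) auto
      then have "edges_h1 E < 8 / 3 * ln 2 * card E"
        using deg N by (intro edges_h1_le_chord(2)[OF E(1)] xlnx_le_chord3(1)) auto
      then show False using E(2) k eq by simp
    qed
    then show ?thesis using edges_complete_if_regular[OF E(1), of 3] E(2) k by simp
  qed
qed

text \<open>The equality case is carried through the induction because the five-edge case has to
  know that its two remaining edges form a star.\<close>

theorem edges_h1_le_max_h1:
  assumes "simple_edges E" "card E = 2 * k"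
  shows "edges_h1 E \<le> max_h1 k \<and> (edges_h1 E = max_h1 k \<longrightarrow> edges_extremal k E)"
  using assms
proof (induction k arbitrary: E rule: less_induct)
  case (less k)
  note E = less.prems
  have fin: "finite E" using E by (simp add: simple_edges_def)
  show ?case
  proof (cases "E = {}")
    case True
    then show ?thesis using E by (simp add: edges_h1_def max_h1_def edges_extremal_def)
  next
    case False
    then obtain v where max: "\<And>u. edge_degree E u \<le> edge_degree E v" "1 \<le> edge_degree E v"
      using ex_max_edge_degree[OF fin] by blast
    define a b where "a = edge_degree E v" and "b = k - a"
    have D: "simple_edges (delete_vertex E v)" by (rule simple_edges_delete_vertex[OF E(1)])
    have ak: "a \<le> k" unfolding a_def by (rule edge_degree_le_half[OF E])
    then have k: "k = a + b" by (simp add: b_def)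
    have card: "card (delete_vertex E v) = 2 * b"
      using card_delete_vertex[OF E(1), of v] E(2) ak by (simp add: a_def b_def)
    have "b < k" using max k by (simp add: a_def)
    note IH = less.IH[OF this D card]
    have deg: "edge_degree E u \<le> a" for u using max by (simp add: a_def)
    note small = edges_h1_le_small_degree[OF E deg]
    \<comment> \<open>For \<open>a <= 3\<close> the split is at \<open>k = 7\<close>, where the star
      overtakes the chord bound for degree 3.\<close>
    consider "b = 0" | "1 \<le> b" "4 \<le> a" | "1 \<le> b" "a \<le> 3" "7 \<le> k"
      | "1 \<le> b" "a = 3" "k \<le> 6" | "1 \<le> b" "a = 2" "k \<le> 6" | "1 \<le> b" "a = 1" "k \<le> 6"
      using max(2) unfolding a_def[symmetric] by linarith
    then show ?thesis
    proof cases
      case 1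
      then have "finite (delete_vertex E v)" "card (delete_vertex E v) = 0"
        using D card by (auto simp: simple_edges_def)
      then have "delete_vertex E v = {}" by simp
      note star = edges_star_if_delete_vertex_empty[OF E(1) this]
      have ka: "edge_degree E v = k" using 1 k by (simp add: a_def)
      show ?thesis
      proof (cases "k = 3 \<or> k = 6")
        case True
        then show ?thesis using star(2) star_less_max_h1 unfolding ka by auto
      next
        case False
        then show ?thesis using star max(2) unfolding ka by (auto simp: max_h1_def edges_extremal_def)
      qed
    next
      case 2
      then show ?thesis
        using edges_h1_less_if_large_degree[OF E(1) card a_def[symmetric]] IH k by fastforce
    next
      case 3
      \<comment> \<open>The chord for degree 3 is applied to smaller maximum degrees
        \<open>a\<close> as well.\<close>
      have "edges_h1 E \<le> 16 / 3 * real k * ln 2"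
        using edges_h1_le_small_degree(3)[OF E, of 3] deg 3 by (meson le_trans)
      also have "\<dots> < max_h1 k" using star_gt_chord3[of k] 3 star_le_max_h1[of k] by linarith
      finally show ?thesis by simp
    next
      case 4
      then consider "k = 4" | "k = 5" | "k = 6" using k by linarith
      then show ?thesis
      proof cases
        case 1
        then have "b = 1" using k 4 by simp
        then show ?thesis using edges_h1_four_edges[OF E(1), of v] card 4 IH 1 by (simp add: a_def)
      next
        case 2
        then have "b = 2" using k 4 by simp
        then show ?thesis
          using edges_h1_five_edges[OF E(1), of v] card 4 IH 2
          by (simp add: a_def edges_extremal_def)
      next
        \<comment> \<open>Here \<open>k = 6\<close>, and the chord bound \<open>32 * ln 2\<close> is
          the maximum itself, attained only by K_4.\<close>
        case 3
        then show ?thesis using small(3,5) 4 by (simp add: max_h1_def edges_extremal_def)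
      qed
    next
      case 5
      \<comment> \<open>The chord bound \<open>3 * k * ln 3\<close> equals the maximum for
        \<open>k = 3\<close>, the triangle, and lies strictly below it for the other values.\<close>
      then consider "k = 3" | "k = 4" | "k = 5" | "k = 6" using k by linarith
      then show ?thesis
        using small(2,4) 5 ln_lincomb_less[of 3 1 5 2 12 0 5 8] ln_lincomb_less[of 3 1 2 1 9 0 16 0]
        by cases (simp_all add: max_h1_def edges_extremal_def xlnx_numerals)
    next
      case 6
      from 6 consider "k = 2" | "k = 3" | "k = 4" | "k = 5" | "k = 6" using k by linarith
      then have "4 * real k * ln 2 < max_h1 k"
        using ln_lincomb_less[of 2 1 3 1 4 0 3 0] ln_lincomb_less[of 2 1 3 1 12 0 9 0]
          ln_lincomb_less[of 2 1 5 1 8 0 5 0] ln_lincomb_less[of 2 1 3 1 2 0 3 0]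
        by cases (simp_all add: max_h1_def xlnx_numerals)
      then show ?thesis using small(1) 6 by simp
    qed
  qed
qed

subsection \<open>Connected graphs\<close>

definition edges_connected :: "'a set \<Rightarrow> ('a \<times> 'a) set \<Rightarrow> bool" where
  "edges_connected V E \<longleftrightarrow> V \<noteq> {} \<and> (\<forall>u\<in>V. \<forall>v\<in>V. (u, v) \<in> E\<^sup>*)"

text \<open>Each other vertex loses exactly one neighbour with \<open>v\<close>. This shift by one
  turns the sum of \<open>xlnx\<close> over the degrees into \<open>h1\<close> of the remaining
  graph.\<close>

lemma edges_universal_vertex:
  assumes E: "simple_edges E" "E \<subseteq> V \<times> V" "finite V" "card E = 2 * m"
    and v: "v \<in> V" "edge_degree E v = card V - 1"
  shows "E `` {v} = V - {v}"
    and "card (delete_vertex E v) = 2 * (m + 1 - card V)"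
    and "\<And>u. u \<in> V - {v} \<Longrightarrow> edge_degree E u = edge_degree (delete_vertex E v) u + 1"
    and "(\<Sum>u\<in>V. xlnx (edge_degree E u)) = xlnx (card V - 1) + edges_h1 (delete_vertex E v)"
proof -
  show nb: "E `` {v} = V - {v}"
    using E v by (intro card_subset_eq) (auto simp: edge_degree_def simple_edges_def irrefl_def)
  have "card V \<noteq> 0" using v E by auto
  then show "card (delete_vertex E v) = 2 * (m + 1 - card V)"
    using card_delete_vertex[OF E(1), of v] E(4) v(2) by simp
  show deg: "edge_degree E u = edge_degree (delete_vertex E v) u + 1" if "u \<in> V - {v}" for u
    using edge_degree_delete_vertex[OF E(1), of u v] that nb by auto
  have "(\<Sum>u\<in>V. xlnx (edge_degree E u)) = xlnx (card V - 1) + (\<Sum>u\<in>V - {v}. xlnx (edge_degree E u))"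
    using E v by (subst sum.remove[of _ v]) auto
  also have "(\<Sum>u\<in>V - {v}. xlnx (edge_degree E u))
      = (\<Sum>u\<in>V - {v}. xlnx (real (edge_degree (delete_vertex E v) u) + 1))"
    by (intro sum.cong refl) (simp only: deg of_nat_add of_nat_1)
  also have "\<dots> = edges_h1 (delete_vertex E v)"
    using E simple_edges_delete_vertex[OF E(1), of v]
    by (intro edges_h1_superset[symmetric]) (auto simp: delete_vertex_def simple_edges_def)
  finally show "(\<Sum>u\<in>V. xlnx (edge_degree E u)) = xlnx (card V - 1) + edges_h1 (delete_vertex E v)" .
qed

text \<open>Otherwise \<open>u\<close> and its neighbours are closed under adjacency, hence exhaust
  \<open>V\<close> by connectedness, and \<open>u\<close> would be universal.\<close>

lemma ex_distance_two:
  assumes E: "simple_edges E" "E \<subseteq> V \<times> V" "finite V" "edges_connected V E"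
    and u: "u \<in> V" "edge_degree E u < card V - 1"
  obtains v w where "(u, v) \<in> E" "(v, w) \<in> E" "(u, w) \<notin> E" "w \<noteq> u"
proof (rule ccontr)
  assume "\<not> thesis"
  with that have closed: "(u, w) \<in> E \<or> w = u" if "(u, v) \<in> E" "(v, w) \<in> E" for v w
    using that by blast
  have "x \<in> insert u (E `` {u})" if "(u, x) \<in> E\<^sup>*" for x
    using that by (induction rule: rtrancl_induct) (use closed in blast)+
  then have "V \<subseteq> insert u (E `` {u})" using E(4) u(1) by (auto simp: edges_connected_def)
  then have "card (V - {u}) \<le> edge_degree E u"
    unfolding edge_degree_def using E(1) by (intro card_mono) (auto simp: simple_edges_def finite_edge_Image)
  then show False using u E(3) by simp
qed

text \<open>The path from \<open>v\<close> over \<open>u\<close> to \<open>w\<close> replaces the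
  removed edge, so connectedness survives. Only the degrees of \<open>u\<close> and \<open>v\<close>
  change, moving further apart, so convexity increases the sum. As \<open>u\<close> stays a vertex
  of maximum degree, the switch can be iterated.\<close>

lemma edges_switch:
  assumes E: "simple_edges E" "E \<subseteq> V \<times> V" "finite V" "edges_connected V E"
    and uvw: "(u, v) \<in> E" "(v, w) \<in> E" "(u, w) \<notin> E" "w \<noteq> u"
    and max: "\<And>x. edge_degree E x \<le> edge_degree E u"
  defines "E' \<equiv> E - {(v, w), (w, v)} \<union> {(u, w), (w, u)}"
  shows "simple_edges E'" "E' \<subseteq> V \<times> V" "edges_connected V E'" "card E' = card E"
    "edge_degree E' u = edge_degree E u + 1" "\<And>x. edge_degree E' x \<le> edge_degree E' u"
    "(\<Sum>x\<in>V. xlnx (edge_degree E x)) < (\<Sum>x\<in>V. xlnx (edge_degree E' x))"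
proof -
  have fin: "finite E" "\<And>x. finite (E `` {x})" and sym: "\<And>x y. (x, y) \<in> E \<Longrightarrow> (y, x) \<in> E"
    and irr: "\<And>x. (x, x) \<notin> E"
    using E(1) by (auto simp: simple_edges_def sym_def irrefl_def finite_edge_Image)
  have ne: "u \<noteq> v" "v \<noteq> w" using uvw irr by auto
  have V: "u \<in> V" "v \<in> V" "w \<in> V" using uvw E(2) by auto
  show "simple_edges E'"
    unfolding simple_edges_def E'_def sym_def irrefl_def using fin sym irr uvw(4) by auto
  show "E' \<subseteq> V \<times> V" using E(2) V by (auto simp: E'_def)
  have vu: "(v, u) \<in> E'" "(u, v) \<in> E'" "(u, w) \<in> E'" "(w, u) \<in> E'"
    using uvw sym ne by (auto simp: E'_def)
  have "(x, y) \<in> E'\<^sup>*" if "(x, y) \<in> E" for x y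
  proof (cases "(x, y) \<in> E'")
    case False
    then have "(x, y) = (v, w) \<or> (x, y) = (w, v)" using that by (auto simp: E'_def)
    then show ?thesis using vu by (metis prod.inject converse_rtrancl_into_rtrancl r_into_rtrancl)
  qed auto
  then have "E\<^sup>* \<subseteq> E'\<^sup>*" by (intro rtrancl_subset_rtrancl) auto
  then show "edges_connected V E'" using E(4) by (auto simp: edges_connected_def)
  have "(w, v) \<in> E" "(w, u) \<notin> E" using uvw sym by blast+
  then have "card (E - {(v, w), (w, v)}) + 2 = card E"
    using uvw ne fin card_mono[of E "{(v, w), (w, v)}"] by (simp add: card_Diff_subset)
  then show "card E' = card E"
    unfolding E'_def using fin uvw \<open>(w, u) \<notin> E\<close> by (subst card_Un_disjoint) auto
  have "E' `` {u} = insert w (E `` {u})" using ne uvw by (auto simp: E'_def)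
  then show du: "edge_degree E' u = edge_degree E u + 1"
    using uvw fin by (simp add: edge_degree_def)
  have "E' `` {v} = E `` {v} - {w}" using ne uvw by (auto simp: E'_def)
  \<comment> \<open>Degree at least 2 keeps \<open>b - 1\<close> positive, as the strict convexity
    estimate requires.\<close>
  moreover have "{u, w} \<subseteq> E `` {v}" using uvw sym by auto
  then have "2 \<le> edge_degree E v"
    unfolding edge_degree_def using fin uvw(4) card_mono[of "E `` {v}" "{u, w}"] by auto
  ultimately have dv: "edge_degree E' v = edge_degree E v - 1" "2 \<le> edge_degree E v"
    using uvw fin by (simp_all add: edge_degree_def)
  have "E' `` {w} = insert u (E `` {w} - {v})" using ne uvw by (auto simp: E'_def)
  moreover have "card (insert u (E `` {w} - {v})) = card (E `` {w})"
    using fin \<open>(w, v) \<in> E\<close> \<open>(w, u) \<notin> E\<close> card_Suc_Diff1[of "E `` {w}" v] by simp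
  ultimately have dw: "edge_degree E' w = edge_degree E w" by (simp add: edge_degree_def)
  have dx: "edge_degree E' x = edge_degree E x" if "x \<notin> {u, v}" for x
  proof (cases "x = w")
    case False
    then have "E' `` {x} = E `` {x}" using that by (auto simp: E'_def)
    then show ?thesis by (simp add: edge_degree_def)
  qed (use dw in simp)
  show "edge_degree E' x \<le> edge_degree E' u" for x
    using max[of x] du dv dx[of x] by (cases "x \<in> {u, v}") auto
  define a b where "a = real (edge_degree E u)" and "b = real (edge_degree E v)"
  have ab: "b \<le> a" "2 \<le> b" using max[of v] dv by (auto simp: a_def b_def)
  have "(\<Sum>x\<in>V. xlnx (edge_degree E x))
      = xlnx a + xlnx b + (\<Sum>x\<in>V - {u, v}. xlnx (edge_degree E x))"
    using V ne E(3) by (subst sum.subset_diff[of "{u, v}"]) (auto simp: a_def b_def)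
  also have "(\<Sum>x\<in>V - {u, v}. xlnx (edge_degree E x)) = (\<Sum>x\<in>V - {u, v}. xlnx (edge_degree E' x))"
    by (intro sum.cong) (auto simp: dx)
  also have "xlnx a + xlnx b < xlnx (a + 1) + xlnx (b - 1)"
    using xlnx_increment_less[of "b - 1" a] ab by simp
  also have "xlnx (a + 1) + xlnx (b - 1) + (\<Sum>x\<in>V - {u, v}. xlnx (edge_degree E' x))
      = (\<Sum>x\<in>V. xlnx (edge_degree E' x))"
    using V ne E(3) du dv
    by (subst (2) sum.subset_diff[of "{u, v}"]) (auto simp: a_def b_def of_nat_diff add.commute)
  finally show "(\<Sum>x\<in>V. xlnx (edge_degree E x)) < (\<Sum>x\<in>V. xlnx (edge_degree E' x))" by simp
qed

text \<open>Switches at the fixed vertex \<open>u\<close> are repeated until it is universal; then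
  the bound on \<open>h1\<close> applies. A switch strictly increases the sum, so equality is
  impossible unless \<open>u\<close> was universal from the start.\<close>

lemma sum_xlnx_degree_le_aux:
  assumes "simple_edges E" "E \<subseteq> V \<times> V" "finite V" "edges_connected V E" "card E = 2 * m"
    and "u \<in> V" "\<And>x. edge_degree E x \<le> edge_degree E u"
  shows "(\<Sum>x\<in>V. xlnx (edge_degree E x)) \<le> xlnx (card V - 1) + max_h1 (m + 1 - card V) \<and>
    ((\<Sum>x\<in>V. xlnx (edge_degree E x)) = xlnx (card V - 1) + max_h1 (m + 1 - card V) \<longrightarrow>
      edge_degree E u = card V - 1 \<and> edges_extremal (m + 1 - card V) (delete_vertex E u))"
  using assms
proof (induction "card V - edge_degree E u" arbitrary: E rule: less_induct)
  case less
  note E = less.prems(1-4)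
  have "E `` {u} \<subseteq> V - {u}" using E(1,2) by (auto simp: simple_edges_def irrefl_def)
  then have le: "edge_degree E u \<le> card V - 1"
    unfolding edge_degree_def using E(3) less.prems(6) card_mono[of "V - {u}" "E `` {u}"] by simp
  show ?case
  proof (cases "edge_degree E u = card V - 1")
    case True
    note univ = edges_universal_vertex[OF E(1-3) less.prems(5,6) True]
    show ?thesis
      using edges_h1_le_max_h1[OF simple_edges_delete_vertex[OF E(1)] univ(2)] univ(4) True by simp
  next
    case False
    then have lt: "edge_degree E u < card V - 1" using le by simp
    obtain v w where uvw: "(u, v) \<in> E" "(v, w) \<in> E" "(u, w) \<notin> E" "w \<noteq> u"
      using ex_distance_two[OF E less.prems(6) lt] by blast
    note sw = edges_switch[OF E uvw less.prems(7)]
    have "card V - edge_degree (E - {(v, w), (w, v)} \<union> {(u, w), (w, u)}) u < card V - edge_degree E u"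
      using sw(5) lt by simp
    from less.hyps[OF this sw(1,2) E(3) sw(3) _ less.prems(6) sw(6)] sw(4,7) less.prems(5)
    show ?thesis by simp
  qed
qed

theorem sum_xlnx_degree_le:
  assumes E: "simple_edges E" "E \<subseteq> V \<times> V" "finite V" "edges_connected V E" "card E = 2 * m"
  shows "(\<Sum>x\<in>V. xlnx (edge_degree E x)) \<le> xlnx (card V - 1) + max_h1 (m + 1 - card V)"
    and "(\<Sum>x\<in>V. xlnx (edge_degree E x)) = xlnx (card V - 1) + max_h1 (m + 1 - card V) \<Longrightarrow>
      \<exists>v\<in>V. edge_degree E v = card V - 1 \<and> edges_extremal (m + 1 - card V) (delete_vertex E v)"
proof -
  have fin: "finite E" using E by (simp add: simple_edges_def)
  obtain u where "u \<in> V" "\<And>x. edge_degree E x \<le> edge_degree E u"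
  proof (cases "E = {}")
    case True
    then show ?thesis using that E(4) by (auto simp: edges_connected_def edge_degree_def)
  next
    case False
    then obtain v where v: "\<And>u. edge_degree E u \<le> edge_degree E v" "1 \<le> edge_degree E v"
      using ex_max_edge_degree[OF fin] by blast
    then have "v \<in> Domain E" using edge_degree_eq_0_iff[OF fin, of v] by fastforce
    then show ?thesis using that[of v] v E(2) by auto
  qed
  from sum_xlnx_degree_le_aux[OF E this] this(1)
  show "(\<Sum>x\<in>V. xlnx (edge_degree E x)) \<le> xlnx (card V - 1) + max_h1 (m + 1 - card V)"
    and "(\<Sum>x\<in>V. xlnx (edge_degree E x)) = xlnx (card V - 1) + max_h1 (m + 1 - card V) \<Longrightarrow>
      \<exists>v\<in>V. edge_degree E v = card V - 1 \<and> edges_extremal (m + 1 - card V) (delete_vertex E v)"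
    by blast+
qed

subsection \<open>Graphs and their edge sets\<close>

text \<open>The map from ordered to unordered pairs has fibres of size two, as there are no
  loops.\<close>

lemma card_eq_two_card_uedges:
  assumes "simple_edges E"
  shows "card E = 2 * card {{u, v} | u v. (u, v) \<in> E}"
proof -
  define f where "f = (\<lambda>(u, v). {u, v :: 'a})"
  have fin: "finite E" and sym: "\<And>x y. (x, y) \<in> E \<Longrightarrow> (y, x) \<in> E" and irr: "\<And>x. (x, x) \<notin> E"
    using assms by (auto simp: simple_edges_def sym_def irrefl_def)
  have img: "{{u, v} | u v. (u, v) \<in> E} = f ` E" by (force simp: f_def)
  have "card E = (\<Sum>y\<in>f ` E. card {x \<in> E. f x = y})"
    using sum.image_gen[OF fin, of "\<lambda>_. 1::nat" f] by simp
  also have "\<dots> = (\<Sum>y\<in>f ` E. 2)"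
  proof (intro sum.cong refl)
    fix y assume "y \<in> f ` E"
    then obtain u v where uv: "(u, v) \<in> E" "y = {u, v}" by (auto simp: f_def)
    then have "{x \<in> E. f x = y} = {(u, v), (v, u)}"
      using sym by (auto simp: f_def doubleton_eq_iff)
    moreover have "u \<noteq> v" using uv irr by auto
    ultimately show "card {x \<in> E. f x = y} = 2" by simp
  qed
  finally show ?thesis by (simp add: img)
qed

context graph
begin

lemma simple_edges_arcs_ends: "simple_edges (arcs_ends G)"
  using sym_arcs no_loops
  by (auto simp: simple_edges_def symmetric_def irrefl_def arcs_ends_def arc_to_ends_def)

lemma arcs_ends_subset: "arcs_ends G \<subseteq> verts G \<times> verts G"
  by (auto simp: arcs_ends_def arc_to_ends_def)

text \<open>Without parallel arcs, out-arcs correspond to out-neighbours through their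
  heads.\<close>

lemma gdeg_eq_edge_degree: "gdeg G v = edge_degree (arcs_ends G) v"
proof -
  have "inj_on (head G) (out_arcs G v)"
    by (rule inj_onI) (auto simp: out_arcs_def arc_to_ends_def intro: no_multi_arcs)
  moreover have "head G ` out_arcs G v = arcs_ends G `` {v}"
    by (auto simp: out_arcs_def arcs_ends_def arc_to_ends_def image_iff)
  ultimately show ?thesis
    unfolding out_degree_def edge_degree_def by (metis card_image)
qed

lemma card_arcs_ends: "card (arcs_ends G) = 2 * gsize G"
  unfolding gsize_def uedges_def by (rule card_eq_two_card_uedges[OF simple_edges_arcs_ends])

lemma h1_eq_edges_h1: "h1 G = edges_h1 (arcs_ends G)"
  using simple_edges_arcs_ends arcs_ends_subset
  by (subst edges_h1_superset[of _ "verts G"])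
     (auto simp: simple_edges_def h1_def xlnx_def gdeg_eq_edge_degree)

text \<open>As the degrees sum to \<open>2 * gsize G\<close>, the normalising logarithm separates.
  For a fixed size, the entropy is thus a decreasing affine function of the sum of
  \<open>xlnx\<close> over the degrees.\<close>

lemma entropy_eq:
  assumes "0 < gsize G"
  shows "entropy G = ln (2 * gsize G)
    - (\<Sum>v\<in>verts G. xlnx (edge_degree (arcs_ends G) v)) / (2 * gsize G)"
proof -
  define M where "M = 2 * real (gsize G)"
  have M: "0 < M" using assms by (simp add: M_def)
  have "(\<Sum>v\<in>verts G. edge_degree (arcs_ends G) v) = 2 * gsize G"
    using simple_edges_arcs_ends arcs_ends_subset card_arcs_ends
    by (subst sum_edge_degree) (auto simp: simple_edges_def)
  then have sum: "(\<Sum>v\<in>verts G. real (edge_degree (arcs_ends G) v)) = M"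
    by (simp add: M_def flip: of_nat_sum)
  have "real d / M * ln (real d / M) = (xlnx d - real d * ln M) / M" for d :: nat
    using M by (cases "d = 0") (simp_all add: xlnx_def ln_div field_simps)
  then have "entropy G = - (\<Sum>v\<in>verts G.
      (xlnx (edge_degree (arcs_ends G) v) - real (edge_degree (arcs_ends G) v) * ln M) / M)"
    by (simp only: entropy_def M_def[symmetric] gdeg_eq_edge_degree)
  also have "\<dots> = - (((\<Sum>v\<in>verts G. xlnx (edge_degree (arcs_ends G) v)) - M * ln M) / M)"
    by (simp add: sum_subtractf sum flip: sum_divide_distrib sum_distrib_right)
  finally show ?thesis using M by (simp add: M_def field_simps)
qed

lemma connected_iff_edges_connected:
  "Digraph_Component.connected G \<longleftrightarrow> edges_connected (verts G) (arcs_ends G)"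
proof -
  have "u \<rightarrow>\<^sup>*\<^bsub>mk_symmetric G\<^esub> v \<longleftrightarrow> (u, v) \<in> (arcs_ends G)\<^sup>*" if "u \<in> verts G" "v \<in> verts G" for u v
    unfolding reachable_mk_symmetric_eq[OF sym_arcs] unfolding reachable_def
    using that arcs_ends_subset by (auto intro: rtrancl_on_rtranclI rtrancl_consistent_rtrancl_on)
  then show ?thesis
    by (auto simp: Digraph_Component.connected_def strongly_connected_def edges_connected_def)
qed

lemma arcs_ends_del_vert: "arcs_ends (del_vert v) = delete_vertex (arcs_ends G) v"
  by (auto simp: arcs_ends_def delete_vertex_def del_vert_simps ends_del_vert)
     (auto simp: arc_to_ends_def image_iff)

lemma graph_del_vert: "graph (del_vert v)"
proof -
  have "sym (arcs_ends (del_vert v))"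
    unfolding arcs_ends_del_vert
    using simple_edges_delete_vertex[OF simple_edges_arcs_ends] by (simp add: simple_edges_def)
  then show ?thesis
    by unfold_locales
       (auto simp: del_vert_simps symmetric_def ends_del_vert no_loops intro: no_multi_arcs)
qed

lemma verts_del_isolated: "verts (del_isolated G) = Domain (arcs_ends G)"
  using arcs_ends_subset simple_edges_arcs_ends edge_degree_eq_0_iff[of "arcs_ends G"]
  by (auto simp: del_isolated_def gdeg_eq_edge_degree simple_edges_def)

lemma arcs_del_isolated: "arcs (del_isolated G) = arcs G"
proof -
  have "tail G e \<in> verts (del_isolated G) \<and> head G e \<in> verts (del_isolated G)" if "e \<in> arcs G" for e
  proof -
    have "(tail G e, head G e) \<in> arcs_ends G" using that by (auto simp: arcs_ends_def arc_to_ends_def)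
    moreover then have "(head G e, tail G e) \<in> arcs_ends G" by (rule graph_symmetric)
    ultimately show ?thesis unfolding verts_del_isolated by blast
  qed
  then show ?thesis by (auto simp: del_isolated_def)
qed

lemma arcs_ends_del_isolated: "arcs_ends (del_isolated G) = arcs_ends G"
proof -
  have "arc_to_ends (del_isolated G) = arc_to_ends G" by (simp add: del_isolated_def)
  then show ?thesis by (simp add: arcs_ends_def arcs_del_isolated)
qed

lemma graph_del_isolated: "graph (del_isolated G)"
proof -
  have *: "tail (del_isolated G) = tail G" "head (del_isolated G) = head G"
    by (simp_all add: del_isolated_def)
  have "tail G e \<in> Domain (arcs_ends G) \<and> head G e \<in> Domain (arcs_ends G)" if "e \<in> arcs G" for e
    using that graph_symmetric[of "tail G e" "head G e"]
    by (auto simp: arcs_ends_def arc_to_ends_def Domain_iff image_iff)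
  moreover have "finite (Domain (arcs_ends G))"
    using simple_edges_arcs_ends by (simp add: simple_edges_def finite_Domain)
  ultimately show ?thesis
    using sym_arcs
    by unfold_locales
       (auto simp: verts_del_isolated arcs_del_isolated * symmetric_def arcs_ends_del_isolated
         arc_to_ends_def no_loops intro: no_multi_arcs)
qed

text \<open>The vertices of \<open>del_isolated G\<close> are \<open>Domain (arcs_ends G)\<close>.
  Here \<open>1 <= k\<close>, and \<open>2 <= j\<close> for complete graphs below, ensures that
  every vertex of the shape has a neighbour, so that this domain is its whole vertex set.\<close>

lemma star_graph_del_isolated_iff:
  assumes "1 \<le> k"
  shows "star_graph k (del_isolated G) \<longleftrightarrow> edges_star k (arcs_ends G)"
proof
  assume "star_graph k (del_isolated G)"
  then obtain U L where *: "U \<inter> L = {}" "card U = 1" "card L = k" "arcs_ends G = U \<times> L \<union> L \<times> U"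
    unfolding star_graph_def complete_bipartite_digraph_def arcs_ends_del_isolated by blast
  then obtain c where "U = {c}" by (meson card_1_singletonE)
  moreover have "finite L" using * assms by (intro card_ge_0_finite) simp
  ultimately show "edges_star k (arcs_ends G)" unfolding edges_star_def using * by blast
next
  assume "edges_star k (arcs_ends G)"
  then obtain c L where *: "c \<notin> L" "finite L" "card L = k" "arcs_ends G = {c} \<times> L \<union> L \<times> {c}"
    unfolding edges_star_def by blast
  have "L \<noteq> {}" using *(3) assms by auto
  then have "verts (del_isolated G) = {c} \<union> L" unfolding verts_del_isolated *(4) by auto
  then show "star_graph k (del_isolated G)"
    unfolding star_graph_def complete_bipartite_digraph_def arcs_ends_del_isolated
    using *(1,3,4) graph_del_isolated by (intro conjI exI[of _ "{c}"] exI[of _ L]) simp_all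
qed

lemma complete_del_isolated_iff:
  assumes "2 \<le> j"
  shows "complete_digraph j (del_isolated G) \<longleftrightarrow> edges_complete j (arcs_ends G)"
proof
  assume "complete_digraph j (del_isolated G)"
  moreover then have "finite (verts (del_isolated G))"
    using assms by (intro card_ge_0_finite) (simp add: complete_digraph_def)
  ultimately show "edges_complete j (arcs_ends G)"
    unfolding complete_digraph_def arcs_ends_del_isolated edges_complete_def by auto
next
  assume "edges_complete j (arcs_ends G)"
  then obtain S where S: "finite S" "card S = j" "arcs_ends G = {(x, y). x \<in> S \<and> y \<in> S \<and> x \<noteq> y}"
    unfolding edges_complete_def by blast
  have "\<exists>y\<in>S. x \<noteq> y" if "x \<in> S" for x
    using S assms card_mono[of "{x}" S] by fastforce
  then have "verts (del_isolated G) = S" unfolding verts_del_isolated S(3) by auto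
  then show "complete_digraph j (del_isolated G)"
    unfolding complete_digraph_def arcs_ends_del_isolated
    using S graph_del_isolated by auto
qed

lemma K4_minus_del_isolated_iff:
  "K4_minus (del_isolated G) \<longleftrightarrow> edges_K4_minus (arcs_ends G)"
proof
  assume "K4_minus (del_isolated G)"
  then obtain u v where "card (verts (del_isolated G)) = 4"
    "u \<in> verts (del_isolated G)" "v \<in> verts (del_isolated G)" "u \<noteq> v"
    "arcs_ends G = {(x, y). x \<in> verts (del_isolated G) \<and> y \<in> verts (del_isolated G) \<and> x \<noteq> y}
      - {(u, v), (v, u)}"
    unfolding K4_minus_def arcs_ends_del_isolated by auto
  then show "edges_K4_minus (arcs_ends G)"
    unfolding edges_K4_minus_def by (intro exI conjI)
next
  assume "edges_K4_minus (arcs_ends G)"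
  then obtain S u v where S: "card S = 4" "u \<in> S" "v \<in> S" "u \<noteq> v"
    and E: "arcs_ends G = {(x, y). x \<in> S \<and> y \<in> S \<and> x \<noteq> y} - {(u, v), (v, u)}"
    unfolding edges_K4_minus_def by blast
  have "\<exists>y\<in>S. y \<notin> {x, u, v}" for x
  proof (rule ccontr)
    assume "\<not> (\<exists>y\<in>S. y \<notin> {x, u, v})"
    then have "card S \<le> card {x, u, v}" by (intro card_mono) auto
    also have "\<dots> \<le> 3" by (simp add: card_insert_if)
    finally show False using S by simp
  qed
  then have "S \<subseteq> Domain (arcs_ends G)" unfolding E by fastforce
  then have "verts (del_isolated G) = S" unfolding verts_del_isolated using E by auto
  then show "K4_minus (del_isolated G)"
    unfolding K4_minus_def arcs_ends_del_isolated
    using S E graph_del_isolated by auto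
qed

lemma extremal_shape_iff: "extremal_shape k G \<longleftrightarrow> edges_extremal k (arcs_ends G)"
proof -
  have "arcs G = {} \<longleftrightarrow> arcs_ends G = {}" by (simp add: arcs_ends_def)
  then show ?thesis
    unfolding extremal_shape_def edges_extremal_def
    using star_graph_del_isolated_iff[of k] star_graph_del_isolated_iff[of 5]
      complete_del_isolated_iff[of 3] complete_del_isolated_iff[of 4] K4_minus_del_isolated_iff
    by auto
qed

end

subsection \<open>Extremal graphs\<close>

lemma edges_star_card:
  assumes "edges_star k E"
  shows "simple_edges E" "card E = 2 * k"
proof -
  from assms obtain c L where cL: "c \<notin> L" "finite L" "card L = k" and E: "E = {c} \<times> L \<union> L \<times> {c}"
    unfolding edges_star_def by blast
  show "simple_edges E"
    unfolding E using cL by (auto simp: simple_edges_def sym_def irrefl_def)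
  have "card ({c} \<times> L \<union> L \<times> {c}) = card ({c} \<times> L) + card (L \<times> {c})"
    using cL by (intro card_Un_disjoint) auto
  then show "card E = 2 * k" using cL(3) by (simp add: E card_cartesian_product)
qed

lemma edges_complete_card:
  assumes "edges_complete j E"
  shows "simple_edges E" "card E = j * (j - 1)"
proof -
  from assms obtain S where S: "finite S" "card S = j" and E: "E = {(x, y). x \<in> S \<and> y \<in> S \<and> x \<noteq> y}"
    unfolding edges_complete_def by blast
  have eq: "E = (SIGMA x:S. S - {x})" unfolding E by auto
  show "simple_edges E"
    unfolding simple_edges_def using S(1) by (auto simp: eq sym_def irrefl_def)
  show "card E = j * (j - 1)"
    unfolding eq using S by simp
qed

lemma edges_K4_minus_card:
  assumes "edges_K4_minus E"
  shows "simple_edges E" "card E = 10"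
proof -
  from assms obtain S u v where S: "card S = 4" "u \<in> S" "v \<in> S" "u \<noteq> v"
    and E: "E = {(x, y). x \<in> S \<and> y \<in> S \<and> x \<noteq> y} - {(u, v), (v, u)}"
    unfolding edges_K4_minus_def by blast
  have "finite S" using S(1) by (intro card_ge_0_finite) simp
  then have "edges_complete 4 {(x, y). x \<in> S \<and> y \<in> S \<and> x \<noteq> y}"
    unfolding edges_complete_def using S(1) by blast
  note K4 = edges_complete_card[OF this]
  show "simple_edges E" using K4(1) unfolding E simple_edges_def sym_def irrefl_def by auto
  show "card E = 10"
    unfolding E using K4 S by (subst card_Diff_subset) auto
qed

text \<open>The shapes are placed on \<open>{1..<n}\<close> so that 0 remains free as a universal
  vertex.\<close>

lemma ex_edges_star:
  assumes "k + 2 \<le> n"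
  shows "\<exists>E :: (nat \<times> nat) set. edges_star k E \<and> E \<subseteq> {1..<n} \<times> {1..<n}"
proof -
  have "edges_star k ({1} \<times> {2..<k+2} \<union> {2..<k+2} \<times> {1 :: nat})"
    unfolding edges_star_def by (intro exI[of _ 1] exI[of _ "{2..<k+2}"]) auto
  moreover have "{1} \<times> {2..<k+2} \<union> {2..<k+2} \<times> {1 :: nat} \<subseteq> {1..<n} \<times> {1..<n}"
    using assms by auto
  ultimately show ?thesis by blast
qed

lemma ex_edges_complete:
  assumes "j < n"
  shows "\<exists>E :: (nat \<times> nat) set. edges_complete j E \<and> E \<subseteq> {1..<n} \<times> {1..<n}"
proof -
  have "edges_complete j {(x, y). x \<in> {1..j} \<and> y \<in> {1..j} \<and> x \<noteq> y}"
    unfolding edges_complete_def by (intro exI[of _ "{1..j}"]) auto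
  moreover have "{(x, y). x \<in> {1..j} \<and> y \<in> {1..j} \<and> x \<noteq> y} \<subseteq> {1..<n} \<times> {1..<n}"
    using assms by auto
  ultimately show ?thesis by blast
qed

lemma ex_edges_K4_minus:
  assumes "4 < n"
  shows "\<exists>E :: (nat \<times> nat) set. edges_K4_minus E \<and> E \<subseteq> {1..<n} \<times> {1..<n}"
proof -
  let ?E = "{(x, y). x \<in> {1..4} \<and> y \<in> {1..4} \<and> x \<noteq> y} - {(1, 2), (2, 1 :: nat)}"
  have "edges_K4_minus ?E"
    unfolding edges_K4_minus_def
    by (intro exI[of _ "{1..4}"] exI[of _ 1] exI[of _ 2]) auto
  moreover have "?E \<subseteq> {1..<n} \<times> {1..<n}" using assms by auto
  ultimately show ?thesis by blast
qed

text \<open>The bound on \<open>n\<close> leaves room for the \<open>k + 1\<close> vertices of a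
  star in \<open>{1..<n}\<close>, and also for K_3 and K_4 at \<open>k = 3\<close> and
  \<open>k = 6\<close>. For \<open>k = 5\<close> the star is chosen.\<close>

lemma ex_edges_extremal:
  assumes "k + 2 \<le> n"
  obtains E :: "(nat \<times> nat) set"
  where "edges_extremal k E" "simple_edges E" "card E = 2 * k" "E \<subseteq> {1..<n} \<times> {1..<n}"
proof -
  consider "k = 0" | "k = 3" | "k = 6" | "1 \<le> k" "k \<notin> {3, 6}" by fastforce
  then show ?thesis
  proof cases
    case 1
    then show ?thesis using that[of "{}"] by (simp add: edges_extremal_def simple_edges_def irrefl_def)
  next
    case 2
    then obtain E :: "(nat \<times> nat) set" where "edges_complete 3 E" "E \<subseteq> {1..<n} \<times> {1..<n}"
      using ex_edges_complete[of 3 n] assms by auto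
    then show ?thesis
      using that[of E] edges_complete_card[of 3 E] 2 by (simp add: edges_extremal_def)
  next
    case 3
    then obtain E :: "(nat \<times> nat) set" where "edges_complete 4 E" "E \<subseteq> {1..<n} \<times> {1..<n}"
      using ex_edges_complete[of 4 n] assms by auto
    then show ?thesis
      using that[of E] edges_complete_card[of 4 E] 3 by (simp add: edges_extremal_def)
  next
    case 4
    obtain E :: "(nat \<times> nat) set" where "edges_star k E" "E \<subseteq> {1..<n} \<times> {1..<n}"
      using ex_edges_star[OF assms] by auto
    then show ?thesis
      using that[of E] edges_star_card[of k E] 4 by (auto simp: edges_extremal_def)
  qed
qed

section \<open>Realizing edge sets by graphs, and cones with apex 0\<close>

definition edge_graph :: "'a set \<Rightarrow> ('a \<times> 'a) set \<Rightarrow> ('a, 'a \<times> 'a) pre_digraph" where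
  "edge_graph V E = \<lparr> verts = V, arcs = E, tail = fst, head = snd \<rparr>"

lemma edge_graph_simps [simp]:
  "verts (edge_graph V E) = V" "arcs_ends (edge_graph V E) = E"
  by (auto simp: edge_graph_def arcs_ends_def arc_to_ends_def)

lemma graph_edge_graph:
  assumes "simple_edges E" "E \<subseteq> V \<times> V" "finite V"
  shows "graph (edge_graph V E)"
  using assms
  by unfold_locales
     (auto simp: edge_graph_def simple_edges_def irrefl_def symmetric_def arcs_ends_def
       arc_to_ends_def)

lemma gsize_edge_graph:
  assumes "simple_edges E" "card E = 2 * k"
  shows "gsize (edge_graph V E) = k"
  using card_eq_two_card_uedges[OF assms(1)] assms(2) by (simp add: gsize_def uedges_def)

text \<open>Inverse to deleting a universal vertex: it makes a connected competitor out of any edge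
  set on \<open>{1..<n}\<close>.\<close>

definition cone :: "nat \<Rightarrow> (nat \<times> nat) set \<Rightarrow> (nat \<times> nat) set" where
  "cone n E = E \<union> {0} \<times> {1..<n} \<union> {1..<n} \<times> {0}"

lemma delete_vertex_cone: "E \<subseteq> {1..<n} \<times> {1..<n} \<Longrightarrow> delete_vertex (cone n E) 0 = E"
  by (auto simp: cone_def delete_vertex_def)

lemma edge_degree_cone:
  assumes "E \<subseteq> {1..<n} \<times> {1..<n}"
  shows "edge_degree (cone n E) 0 = n - 1"
proof -
  have "cone n E `` {0} = {1..<n}" using assms by (auto simp: cone_def)
  then show ?thesis by (simp add: edge_degree_def)
qed

lemma simple_edges_cone:
  assumes "simple_edges E" "E \<subseteq> {1..<n} \<times> {1..<n}"
  shows "simple_edges (cone n E)"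
  using assms by (auto simp: cone_def simple_edges_def sym_def irrefl_def)

lemma connected_graph_cone:
  assumes E: "simple_edges E" "E \<subseteq> {1..<n} \<times> {1..<n}" "card E = 2 * (m + 1 - n)"
    and n: "1 \<le> n" "n - 1 \<le> m"
  shows "connected_graph n m (edge_graph {..<n} (cone n E))"
proof -
  note S = simple_edges_cone[OF E(1,2)]
  have sub: "cone n E \<subseteq> {..<n} \<times> {..<n}" using E(2) n by (auto simp: cone_def)
  interpret graph "edge_graph {..<n} (cone n E)" by (rule graph_edge_graph) (use S sub in auto)
  have "(u, 0) \<in> (cone n E)\<^sup>*" "(0, u) \<in> (cone n E)\<^sup>*" if "u < n" for u
    using that by (cases "u = 0"; auto simp: cone_def intro!: r_into_rtrancl)+
  then have "edges_connected {..<n} (cone n E)"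
    unfolding edges_connected_def using n by (auto intro: rtrancl_trans[of _ 0] simp: lessThan_empty_iff)
  moreover have "card (cone n E) = 2 * m"
    using card_delete_vertex[OF S, of 0] delete_vertex_cone[OF E(2)] edge_degree_cone[OF E(2)] E(3) n
    by simp
  ultimately show ?thesis
    using gsize_edge_graph[OF S, of m "{..<n}"] graph_axioms
    by (simp add: connected_graph_def gorder_def connected_iff_edges_connected)
qed

lemma sum_xlnx_cone:
  assumes "simple_edges E" "E \<subseteq> {1..<n} \<times> {1..<n}" "1 \<le> n"
  shows "(\<Sum>v<n. xlnx (edge_degree (cone n E) v)) = xlnx (n - 1) + edges_h1 E"
proof -
  note S = simple_edges_cone[OF assms(1,2)]
  have "cone n E \<subseteq> {..<n} \<times> {..<n}" using assms by (auto simp: cone_def)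
  \<comment> \<open>\<open>edges_universal_vertex\<close> is stated for edge sets of cardinality
    \<open>2 * m\<close>, so some such \<open>m\<close> has to be produced.\<close>
  moreover have "even (card (cone n E))" using card_eq_two_card_uedges[OF S] by simp
  then obtain m where "card (cone n E) = 2 * m" by blast
  ultimately have "(\<Sum>v\<in>{..<n}. xlnx (edge_degree (cone n E) v))
      = xlnx (card {..<n} - 1) + edges_h1 (delete_vertex (cone n E) 0)"
    using assms edge_degree_cone[OF assms(2)]
    by (intro edges_universal_vertex(4)[OF S]) auto
  then show ?thesis using delete_vertex_cone[OF assms(2)] by simp
qed

text \<open>The cone over an extremal edge set attains the upper bound on the sum of
  \<open>xlnx\<close>, and it is a graph on natural numbers. So comparison with those competitors
  already fixes the optimal value for a graph of any type.\<close>

lemma entropy_minimizer_iff: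
  assumes "2 \<le> n" "n - 1 \<le> m" "m \<le> 2 * n - 3"
  shows "entropy_minimizer n m G \<longleftrightarrow> connected_graph n m G \<and>
    (\<Sum>v\<in>verts G. xlnx (edge_degree (arcs_ends G) v)) = xlnx (n - 1) + max_h1 (m + 1 - n)"
proof -
  have m: "0 < m" using assms by simp
  \<comment> \<open>This fact and the next are generic in the types, to be used both for
    \<open>G\<close> and for graphs on natural numbers.\<close>
  have ent: "entropy H = ln (2 * m) - (\<Sum>v\<in>verts H. xlnx (edge_degree (arcs_ends H) v)) / (2 * m)"
    if "connected_graph n m H" for H :: "('c, 'd) pre_digraph"
    using graph.entropy_eq[of H] that m by (simp add: connected_graph_def)
  have le: "(\<Sum>v\<in>verts H. xlnx (edge_degree (arcs_ends H) v)) \<le> xlnx (n - 1) + max_h1 (m + 1 - n)"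
    if H: "connected_graph n m H" for H :: "('c, 'd) pre_digraph"
  proof -
    interpret graph H using H by (simp add: connected_graph_def)
    show ?thesis
      using sum_xlnx_degree_le(1)[OF simple_edges_arcs_ends arcs_ends_subset finite_verts, of m]
        H connected_iff_edges_connected card_arcs_ends
      by (simp add: connected_graph_def gorder_def)
  qed
  obtain E where E: "edges_extremal (m + 1 - n) E" "simple_edges E" "card E = 2 * (m + 1 - n)"
    "E \<subseteq> {1..<n} \<times> {1..<n}"
  proof (rule ex_edges_extremal)
    show "m + 1 - n + 2 \<le> n" using assms by linarith
  qed
  define C where "C = edge_graph {..<n} (cone n E)"
  have C: "connected_graph n m C"
    "(\<Sum>v\<in>verts C. xlnx (edge_degree (arcs_ends C) v)) = xlnx (n - 1) + max_h1 (m + 1 - n)"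
    using connected_graph_cone[OF E(2,4,3)] sum_xlnx_cone[OF E(2,4)] edges_h1_extremal[OF E(1)] assms
    by (simp_all add: C_def)
  show ?thesis
  proof
    assume min: "entropy_minimizer n m G"
    then have G: "connected_graph n m G" and "entropy G \<le> entropy C"
      using C(1) by (auto simp: entropy_minimizer_def)
    then have "xlnx (n - 1) + max_h1 (m + 1 - n) \<le> (\<Sum>v\<in>verts G. xlnx (edge_degree (arcs_ends G) v))"
      using ent[OF G] ent[OF C(1)] C(2) m by (simp add: divide_right_mono_neg divide_le_cancel)
    then show "connected_graph n m G \<and>
        (\<Sum>v\<in>verts G. xlnx (edge_degree (arcs_ends G) v)) = xlnx (n - 1) + max_h1 (m + 1 - n)"
      using le[OF G] G by simp
  next
    assume G: "connected_graph n m G \<and>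
        (\<Sum>v\<in>verts G. xlnx (edge_degree (arcs_ends G) v)) = xlnx (n - 1) + max_h1 (m + 1 - n)"
    have "entropy G \<le> entropy H" if H: "connected_graph n m H" for H :: "(nat, nat \<times> nat) pre_digraph"
      using ent[of G] ent[OF H] le[OF H] G by (simp add: divide_right_mono)
    then show "entropy_minimizer n m G" using G by (simp add: entropy_minimizer_def)
  qed
qed

text \<open>As for the entropy: some graph on natural numbers attains \<open>max_h1 k\<close>, so
  being a maximizer means having this value.\<close>

lemma h1_maximizer_iff:
  assumes "graph H" "gsize H = k"
  shows "h1_maximizer k H \<longleftrightarrow> extremal_shape k H"
proof -
  have le: "h1 K \<le> max_h1 k \<and> (h1 K = max_h1 k \<longleftrightarrow> extremal_shape k K)"
    if K: "graph K" "gsize K = k" for K :: "('c, 'd) pre_digraph"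
  proof -
    interpret graph K by (rule K)
    show ?thesis
      using edges_h1_le_max_h1[OF simple_edges_arcs_ends, of k] edges_h1_extremal[of k "arcs_ends K"]
        card_arcs_ends K(2) by (auto simp: h1_eq_edges_h1 extremal_shape_iff)
  qed
  obtain E where E: "edges_extremal k E" "simple_edges E" "card E = 2 * k"
    "E \<subseteq> {1..<k + 2} \<times> {1..<k + 2}"
    using ex_edges_extremal[of k "k + 2"] by auto
  define C where "C = edge_graph {1..<k + 2} E"
  have C: "graph C" "gsize C = k"
    using graph_edge_graph[OF E(2,4)] gsize_edge_graph[OF E(2,3)] by (simp_all add: C_def)
  then have "h1 C = max_h1 k"
    using E(1) le[OF C] graph.extremal_shape_iff[of C k] by (simp add: C_def)
  then show ?thesis
    using le C assms unfolding h1_maximizer_def by (metis order_antisym)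
qed

section \<open>Degree sequences of the extremal graphs\<close>

lemma image_mset_mset_set_const:
  "(\<And>x. x \<in> A \<Longrightarrow> f x = c) \<Longrightarrow> image_mset f (mset_set A) = replicate_mset (card A) c"
  using image_mset_cong[of "mset_set A" f "\<lambda>_. c"]
  by (cases "finite A") (simp_all add: image_mset_const_eq)

lemma image_mset_mset_set_split:
  assumes "finite W" "A \<subseteq> W"
  shows "image_mset f (mset_set W) = image_mset f (mset_set A) + image_mset f (mset_set (W - A))"
proof -
  have "mset_set W = mset_set A + mset_set (W - A)"
    using assms mset_set_Union[of A "W - A"] by (simp add: finite_subset Un_absorb1)
  then show ?thesis by simp
qed

text \<open>The \<open>+ 1\<close> accounts for the edge to the universal vertex, so vertices
  outside \<open>Domain E\<close> end up as leaves.\<close>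

lemma degrees_edges_split:
  assumes "finite W" "Domain E \<subseteq> W" "finite E"
  shows "image_mset (\<lambda>w. edge_degree E w + 1) (mset_set W)
    = image_mset (\<lambda>w. edge_degree E w + 1) (mset_set (Domain E))
      + replicate_mset (card W - card (Domain E)) 1"
proof -
  have "image_mset (\<lambda>w. edge_degree E w + 1) (mset_set (W - Domain E))
      = replicate_mset (card (W - Domain E)) 1"
    using edge_degree_eq_0_iff[OF assms(3)] by (intro image_mset_mset_set_const) simp
  then show ?thesis
    using assms by (subst image_mset_mset_set_split[OF assms(1,2)]) (simp add: card_Diff_subset finite_Domain)
qed

lemma degrees_edges_star:
  assumes "edges_star k E" "1 \<le> k" "finite W" "Domain E \<subseteq> W"
  shows "image_mset (\<lambda>w. edge_degree E w + 1) (mset_set W)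
    = {#k + 1#} + replicate_mset k 2 + replicate_mset (card W - (k + 1)) 1"
proof -
  from assms(1) obtain c L where cL: "c \<notin> L" "finite L" "card L = k" and E: "E = {c} \<times> L \<union> L \<times> {c}"
    unfolding edges_star_def by blast
  have "L \<noteq> {}" using cL(3) assms(2) by auto
  then have D: "Domain E = insert c L" unfolding E by auto
  have "E `` {c} = L" unfolding E using cL(1) by auto
  then have c: "edge_degree E c = k" using cL by (simp add: edge_degree_def)
  have "edge_degree E x = 1" if "x \<in> L" for x
  proof -
    have "E `` {x} = {c}" unfolding E using cL(1) that by auto
    then show ?thesis by (simp add: edge_degree_def)
  qed
  then have "image_mset (\<lambda>w. edge_degree E w + 1) (mset_set L) = replicate_mset k 2"
    by (subst image_mset_mset_set_const[of _ _ 2]) (simp_all add: cL)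
  then show ?thesis
    using degrees_edges_split[OF assms(3,4)] edges_star_card(1)[OF assms(1)] cL(1-3) c
    by (simp add: D simple_edges_def)
qed

lemma degrees_edges_complete:
  assumes "edges_complete j E" "2 \<le> j" "finite W" "Domain E \<subseteq> W"
  shows "image_mset (\<lambda>w. edge_degree E w + 1) (mset_set W)
    = replicate_mset j j + replicate_mset (card W - j) 1"
proof -
  from assms(1) obtain S where S: "finite S" "card S = j" and E: "E = {(x, y). x \<in> S \<and> y \<in> S \<and> x \<noteq> y}"
    unfolding edges_complete_def by blast
  have "\<exists>y\<in>S. x \<noteq> y" for x
    using S assms(2) card_mono[of "{x}" S] by fastforce
  then have D: "Domain E = S" unfolding E by auto
  have "edge_degree E x + 1 = j" if "x \<in> S" for x
  proof -
    have "E `` {x} = S - {x}" unfolding E using that by auto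
    then show ?thesis using S that assms(2) by (simp add: edge_degree_def)
  qed
  then have "image_mset (\<lambda>w. edge_degree E w + 1) (mset_set S) = replicate_mset j j"
    by (subst image_mset_mset_set_const[of _ _ j]) (simp_all add: S)
  then show ?thesis
    using degrees_edges_split[OF assms(3,4)] edges_complete_card(1)[OF assms(1)] S
    by (simp add: D simple_edges_def)
qed

lemma degrees_edges_K4_minus:
  assumes "edges_K4_minus E" "finite W" "Domain E \<subseteq> W"
  shows "image_mset (\<lambda>w. edge_degree E w + 1) (mset_set W)
    = replicate_mset 2 4 + replicate_mset 2 3 + replicate_mset (card W - 4) 1"
proof -
  from assms obtain S u v where S: "card S = 4" "u \<in> S" "v \<in> S" "u \<noteq> v"
    and E: "E = {(x, y). x \<in> S \<and> y \<in> S \<and> x \<noteq> y} - {(u, v), (v, u)}"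
    unfolding edges_K4_minus_def by blast
  have fS: "finite S" using S(1) by (intro card_ge_0_finite) simp
  have "edge_degree E x + 1 = (if x \<in> {u, v} then 3 else 4)" if "x \<in> S" for x
  proof -
    have "E `` {x} = (if x \<in> {u, v} then S - {u, v} else S - {x})" unfolding E using that by auto
    then show ?thesis using fS S that by (auto simp: edge_degree_def card_Diff_subset)
  qed
  note deg = this
  have "x \<in> Domain E" if "x \<in> S" for x
    using deg[OF that] edge_degree_eq_0_iff[of E x] edges_K4_minus_card(1)[OF assms(1)]
    by (auto simp: simple_edges_def split: if_splits)
  moreover have "Domain E \<subseteq> S" unfolding E by auto
  ultimately have D: "Domain E = S" by blast
  have "image_mset (\<lambda>w. edge_degree E w + 1) (mset_set S)
      = image_mset (\<lambda>w. edge_degree E w + 1) (mset_set {u, v})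
        + image_mset (\<lambda>w. edge_degree E w + 1) (mset_set (S - {u, v}))"
    using fS S by (intro image_mset_mset_set_split) auto
  also have "image_mset (\<lambda>w. edge_degree E w + 1) (mset_set {u, v}) = replicate_mset 2 3"
    using S deg[of u] deg[of v] by (subst image_mset_mset_set_const[of _ _ 3])
      (auto simp: numeral_2_eq_2)
  also have "image_mset (\<lambda>w. edge_degree E w + 1) (mset_set (S - {u, v})) = replicate_mset 2 4"
    using S fS deg by (subst image_mset_mset_set_const[of _ _ 4]) (auto simp: card_Diff_subset)
  finally show ?thesis
    using degrees_edges_split[OF assms(2,3)] edges_K4_minus_card(1)[OF assms(1)] S
    by (simp add: D simple_edges_def)
qed

lemma (in graph) degree_sequence_universal:
  assumes "v \<in> verts G" "gdeg G v = card (verts G) - 1"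
  shows "degree_sequence G = {#card (verts G) - 1#}
    + image_mset (\<lambda>w. edge_degree (delete_vertex (arcs_ends G) v) w + 1) (mset_set (verts G - {v}))"
proof -
  have "degree_sequence G = {#card (verts G) - 1#} + image_mset (gdeg G) (mset_set (verts G - {v}))"
    using assms unfolding degree_sequence_def
    by (subst image_mset_mset_set_split[of _ "{v}"]) auto
  also have "image_mset (gdeg G) (mset_set (verts G - {v}))
      = image_mset (\<lambda>w. edge_degree (delete_vertex (arcs_ends G) v) w + 1) (mset_set (verts G - {v}))"
    using edges_universal_vertex(3)[OF simple_edges_arcs_ends arcs_ends_subset finite_verts
        card_arcs_ends assms(1)] assms(2)
    by (intro image_mset_cong) (simp add: gdeg_eq_edge_degree)
  finally show ?thesis .
qed


theorem theorem8:
  fixes n m :: nat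
  assumes "n \<ge> 2" and "n - 1 \<le> m" and "m \<le> 2 * n - 3"
  shows
    "(\<forall>G :: ('a, 'b) pre_digraph. entropy_minimizer n m G \<longrightarrow>
        (\<exists>v\<in>verts G. gdeg G v = n - 1 \<and>
            graph (pre_digraph.del_vert G v) \<and>
            gorder (pre_digraph.del_vert G v) = n - 1 \<and>
            gsize (pre_digraph.del_vert G v) = m + 1 - n \<and>
            extremal_shape (m + 1 - n) (pre_digraph.del_vert G v)) \<and>
        ((n + 6 \<le> m \<and> m \<le> 2 * n - 3) \<or> m \<in> {n, n + 1, n + 3} \<longrightarrow>
            degree_sequence G = {#n - 1, m + 2 - n#} + replicate_mset (m + 1 - n) 2
                                  + replicate_mset (2 * n - m - 3) 1) \<and>
        (m = n + 5 \<longrightarrow>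
            degree_sequence G = {#n - 1#} + replicate_mset 4 4 + replicate_mset (n - 5) 1) \<and>
        (m = n + 4 \<longrightarrow>
            degree_sequence G = {#n - 1#} + replicate_mset 2 4 + replicate_mset 2 3
                                  + replicate_mset (n - 5) 1 \<or>
            degree_sequence G = {#n - 1, 6#} + replicate_mset 5 2 + replicate_mset (n - 7) 1) \<and>
        (m = n + 2 \<longrightarrow>
            degree_sequence G = {#n - 1#} + replicate_mset 3 3 + replicate_mset (n - 4) 1) \<and>
        (m = n - 1 \<longrightarrow>
            degree_sequence G = {#n - 1#} + replicate_mset (n - 1) 1)) \<and>
     (\<forall>H :: ('a, 'b) pre_digraph. graph H \<and> gsize H = m + 1 - n \<longrightarrow>
        (h1_maximizer (m + 1 - n) H \<longleftrightarrow> extremal_shape (m + 1 - n) H)) \<and>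
     (m = n + 4 \<longrightarrow>
        (\<exists>G :: (nat, nat \<times> nat) pre_digraph. entropy_minimizer n m G \<and>
            degree_sequence G = {#n - 1#} + replicate_mset 2 4 + replicate_mset 2 3
                                  + replicate_mset (n - 5) 1) \<and>
        (\<exists>G :: (nat, nat \<times> nat) pre_digraph. entropy_minimizer n m G \<and>
            degree_sequence G = {#n - 1, 6#} + replicate_mset 5 2 + replicate_mset (n - 7) 1))"
proof (intro conjI allI impI)
  \<comment> \<open>The number of edges that remain after deleting the universal vertex.\<close>
  define k where "k = m + 1 - n"
  have n: "2 \<le> n" and kn: "k + 2 \<le> n" and m: "m = n - 1 + k"
    using assms by (auto simp: k_def)
  note min_iff = entropy_minimizer_iff[OF assms]
  {
    fix G :: "('a, 'b) pre_digraph"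
    assume min: "entropy_minimizer n m G"
    then have G: "connected_graph n m G"
      and opt: "(\<Sum>v\<in>verts G. xlnx (edge_degree (arcs_ends G) v)) = xlnx (n - 1) + max_h1 k"
      using min_iff[of G] by (auto simp: k_def)
    interpret graph G using G by (simp add: connected_graph_def)
    have ord: "card (verts G) = n" and size: "card (arcs_ends G) = 2 * m"
      and con: "edges_connected (verts G) (arcs_ends G)"
      using G card_arcs_ends connected_iff_edges_connected by (auto simp: connected_graph_def gorder_def)
    obtain v where v: "v \<in> verts G" "edge_degree (arcs_ends G) v = n - 1"
      and ext: "edges_extremal k (delete_vertex (arcs_ends G) v)"
      using sum_xlnx_degree_le(2)[OF simple_edges_arcs_ends arcs_ends_subset finite_verts con size]
        opt ord by (auto simp: k_def)
    define E where "E = delete_vertex (arcs_ends G) v"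
    define W where "W = verts G - {v}"
    have W: "finite W" "card W = n - 1" "Domain E \<subseteq> W"
      using v ord arcs_ends_subset by (auto simp: W_def E_def delete_vertex_def)
    interpret D: graph "del_vert v" by (rule graph_del_vert)
    have "card E = 2 * k"
      using edges_universal_vertex(2)[OF simple_edges_arcs_ends arcs_ends_subset finite_verts size v(1)]
        v(2) ord by (simp add: E_def k_def)
    then have "gsize (del_vert v) = k"
      using D.card_arcs_ends by (simp add: arcs_ends_del_vert E_def)
    moreover have "extremal_shape k (del_vert v)"
      using ext by (simp add: D.extremal_shape_iff arcs_ends_del_vert)
    ultimately show "\<exists>v\<in>verts G. gdeg G v = n - 1 \<and> graph (del_vert v) \<and>
        gorder (del_vert v) = n - 1 \<and> gsize (del_vert v) = m + 1 - n \<and>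
        extremal_shape (m + 1 - n) (del_vert v)"
      using v W D.graph_axioms
      by (intro bexI[of _ v]) (auto simp: gdeg_eq_edge_degree gorder_def verts_del_vert W_def k_def)
    have seq: "degree_sequence G
        = {#n - 1#} + image_mset (\<lambda>w. edge_degree E w + 1) (mset_set W)"
      using degree_sequence_universal[of v] v ord by (simp add: gdeg_eq_edge_degree E_def W_def)
    note star = degrees_edges_star[OF _ _ W(1,3)] and complete = degrees_edges_complete[OF _ _ W(1,3)]
      and K4m = degrees_edges_K4_minus[OF _ W(1,3)]
    note ext' = ext[folded E_def, unfolded edges_extremal_def]
    {
      \<comment> \<open>Since \<open>m = n - 1 + k\<close>, these are the cases
        \<open>7 <= k\<close> and \<open>k\<close> equal to 1, 2 or 4, in which the star is the only
        extremal shape.\<close>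
      assume "n + 6 \<le> m \<and> m \<le> 2 * n - 3 \<or> m \<in> {n, n + 1, n + 3}"
      then have "1 \<le> k" "k \<notin> {3, 5, 6}" using n m by auto
      moreover have "n - 1 - (k + 1) = 2 * n - m - 3" "m + 2 - n = k + 1" "m + 1 - n = k"
        using kn m by auto
      ultimately show "degree_sequence G = {#n - 1, m + 2 - n#} + replicate_mset (m + 1 - n) 2
          + replicate_mset (2 * n - m - 3) 1"
        using ext' star[of k] W(2) by (simp add: seq)
    }
    {
      assume "m = n + 5"
      then have "k = 6" using n m by auto
      then show "degree_sequence G = {#n - 1#} + replicate_mset 4 4 + replicate_mset (n - 5) 1"
        using ext' complete[of 4] W(2) by (simp add: seq)
    }
    {
      assume "m = n + 4"
      then have "k = 5" using n m by auto
      then show "degree_sequence G = {#n - 1#} + replicate_mset 2 4 + replicate_mset 2 3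
            + replicate_mset (n - 5) 1 \<or>
          degree_sequence G = {#n - 1, 6#} + replicate_mset 5 2 + replicate_mset (n - 7) 1"
        using ext' star[of 5] K4m W(2) by (auto simp: seq)
    }
    {
      assume "m = n + 2"
      then have "k = 3" using n m by auto
      then show "degree_sequence G = {#n - 1#} + replicate_mset 3 3 + replicate_mset (n - 4) 1"
        using ext' complete[of 3] W(2) by (simp add: seq)
    }
    {
      assume "m = n - 1"
      then have "E = {}" using ext' m by simp
      then have "image_mset (\<lambda>w. edge_degree E w + 1) (mset_set W) = replicate_mset (n - 1) 1"
        using image_mset_mset_set_const[of W "\<lambda>w. edge_degree E w + 1" 1] W(2)
        by (simp add: edge_degree_def)
      then show "degree_sequence G = {#n - 1#} + replicate_mset (n - 1) 1" by (simp add: seq)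
    }
  }
  {
    fix H :: "('a, 'b) pre_digraph"
    assume "graph H \<and> gsize H = m + 1 - n"
    then show "h1_maximizer (m + 1 - n) H \<longleftrightarrow> extremal_shape (m + 1 - n) H"
      using h1_maximizer_iff by blast
  }
  {
    assume m4: "m = n + 4"
    then have k: "k = 5" using n m by auto
    \<comment> \<open>Every extremal edge set with 5 edges gives a minimizer, so it remains to
      insert K_4 minus an edge and the star.\<close>
    have cone_min: "entropy_minimizer n m (edge_graph {..<n} (cone n E)) \<and>
        degree_sequence (edge_graph {..<n} (cone n E))
          = {#n - 1#} + image_mset (\<lambda>w. edge_degree E w + 1) (mset_set {1..<n})"
      if E: "edges_extremal 5 E" "simple_edges E" "card E = 10" "E \<subseteq> {1..<n} \<times> {1..<n}" for E
    proof -
      have con: "connected_graph n m (edge_graph {..<n} (cone n E))"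
        using E m4 n by (intro connected_graph_cone) auto
      then interpret graph "edge_graph {..<n} (cone n E)" by (simp add: connected_graph_def)
      have "{..<n} - {0} = {1..<n}" by auto
      then show ?thesis
        using min_iff[of "edge_graph {..<n} (cone n E)"] con sum_xlnx_cone[OF E(2,4)]
          edges_h1_extremal[OF E(1)] degree_sequence_universal[of 0] edge_degree_cone[OF E(4)]
          delete_vertex_cone[OF E(4)] n k
        by (simp add: k_def gdeg_eq_edge_degree)
    qed
    obtain E where E: "edges_K4_minus E" "E \<subseteq> {1..<n} \<times> {1..<n}"
      using ex_edges_K4_minus[of n] kn k by auto
    then have "Domain E \<subseteq> {1..<n}" by auto
    then show "\<exists>G :: (nat, nat \<times> nat) pre_digraph. entropy_minimizer n m G \<and>
        degree_sequence G = {#n - 1#} + replicate_mset 2 4 + replicate_mset 2 3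
          + replicate_mset (n - 5) 1"
      using cone_min[of E] E edges_K4_minus_card[OF E(1)] degrees_edges_K4_minus[OF E(1), of "{1..<n}"]
      by (intro exI[of _ "edge_graph {..<n} (cone n E)"]) (auto simp: edges_extremal_def)
    obtain E where E: "edges_star 5 E" "E \<subseteq> {1..<n} \<times> {1..<n}"
      using ex_edges_star[of 5 n] kn k by auto
    then have "Domain E \<subseteq> {1..<n}" by auto
    then show "\<exists>G :: (nat, nat \<times> nat) pre_digraph. entropy_minimizer n m G \<and>
        degree_sequence G = {#n - 1, 6#} + replicate_mset 5 2 + replicate_mset (n - 7) 1"
      using cone_min[of E] E edges_star_card[OF E(1)] degrees_edges_star[OF E(1), of "{1..<n}"]
      by (intro exI[of _ "edge_graph {..<n} (cone n E)"]) (auto simp: edges_extremal_def)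
  }
qed

end
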